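(* Let $S\subset\mathbb{N}$ and $A_S=\left\{\sum_{i\in S}x_i2^{-i}: x_i\in\{0,1\}\right\}\subset\mathbb{R}$. Then $$\left\{\dim_H^D A_S: D\in\mathcal{D}\right\}=[\dim_H A_S,\dim_P A_S].$$
   Context: $\mathbb{N}$ is the set of positive integers and $|E|$ denotes the diameter of a set $E$. $\mathcal{D}$ is the family of all sets $D\subset(0,\infty)$ with $\inf D=0$ that are open in the Sorgenfrey topology (generated by the intervals $[a,b)$), i.e. for every $t\in D$ there is $\delta>0$ with $[t,t+\delta)\subset D$. For $D\in\mathcal{D}$, $E\subset\mathbb{R}^n$ and $s\ge0$ let $$\mathcal{H}^s_{D,\infty}(E)=\inf\left\{\sum_{i=1}^\infty|E_i|^s: E\subset\bigcup_{i=1}^\infty E_i,\ |E_i|\in D\text{ for all }i\right\},\qquad \dim_H^D E=\inf\{s\ge0:\mathcal{H}^s_{D,\infty}(E)=0\}.$$ $\dim_H$ and $\dim_P$ are the Hausdorff and packing dimensions. *)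

theory Defs
  imports "HOL-Analysis.Analysis"
begin

section \<open>The family of admissible diameter sets\<close>

definition sorgenfrey :: "real topology" where
  "sorgenfrey = topology_generated_by {{a..<b} | a b. True}"

lemma openin_sorgenfrey_iff:
  "openin sorgenfrey D \<longleftrightarrow> (\<forall>t\<in>D. \<exists>\<delta>>0. {t..<t+\<delta>} \<subseteq> D)"
proof
  assume "openin sorgenfrey D"
  then have "generate_topology_on {{a..<b::real} | a b. True} D"
    unfolding sorgenfrey_def openin_topology_generated_by_iff .
  then show "\<forall>t\<in>D. \<exists>\<delta>>0. {t..<t+\<delta>} \<subseteq> D"
  proof induction
    case (Int A B)
    show ?case
    proof
      fix t assume "t \<in> A \<inter> B"
      then obtain d e where "d > 0" "{t..<t+d} \<subseteq> A" "e > 0" "{t..<t+e} \<subseteq> B"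
        using Int by blast
      then have "min d e > 0 \<and> {t..<t + min d e} \<subseteq> A \<inter> B"
        by (auto simp: subset_iff)
      then show "\<exists>\<delta>>0. {t..<t+\<delta>} \<subseteq> A \<inter> B" by blast
    qed
  next
    case (UN K)
    show ?case
    proof
      fix t assume "t \<in> \<Union>K"
      then obtain A where "A \<in> K" "t \<in> A" by auto
      moreover then obtain d where "d > 0" "{t..<t+d} \<subseteq> A" using UN by blast
      ultimately show "\<exists>\<delta>>0. {t..<t+\<delta>} \<subseteq> \<Union>K" by blast
    qed
  next
    case (Basis A)
    then obtain a b where "A = {a..<b}" by auto
    show ?case
    proof
      fix t assume "t \<in> A"
      then show "\<exists>\<delta>>0. {t..<t+\<delta>} \<subseteq> A"
        using \<open>A = {a..<b}\<close> by (intro exI[of _ "b - t"]) auto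
    qed
  qed auto
next
  assume R: "\<forall>t\<in>D. \<exists>\<delta>>0. {t..<t+\<delta>} \<subseteq> D"
  have basic: "openin sorgenfrey {a..<b}" for a b
    unfolding sorgenfrey_def by (rule topology_generated_by_Basis) auto
  have "\<exists>T. openin sorgenfrey T \<and> t \<in> T \<and> T \<subseteq> D" if t: "t \<in> D" for t
  proof -
    obtain \<delta> where "\<delta> > 0" "{t..<t+\<delta>} \<subseteq> D" using bspec[OF R t] by auto
    then show ?thesis using basic[of t "t+\<delta>"] by (intro exI[of _ "{t..<t+\<delta>}"]) auto
  qed
  then show "openin sorgenfrey D"
    by (subst openin_subopen) simp
qed

text \<open>Nonemptiness is part of the condition that the infimum is 0, since the infimum of
  the empty set is infinite, whereas \<^term>\<open>Inf {} :: real\<close> is an arbitrary real.\<close>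

definition diam_families :: "real set set" where
  "diam_families = {D. D \<subseteq> {0<..} \<and> D \<noteq> {} \<and> Inf D = 0 \<and> openin sorgenfrey D}"

section \<open>Dimensions\<close>

text \<open>The dimensions below are real infima. The sets involved are nonempty, because in a
  Euclidean space they contain every \<open>s > DIM('a)\<close>.\<close>

text \<open>\<^const>\<open>diameter\<close> is meaningful only for bounded sets, so boundedness is required explicitly;
  \<open>diameter (U i) \<in> D\<close> is meant to imply that \<open>U i\<close> has finite diameter.\<close>

definition diam_content ::
    "real set \<Rightarrow> real \<Rightarrow> 'a::euclidean_space set \<Rightarrow> ennreal" where
  "diam_content D s E =
     Inf {(\<Sum>i. ennreal (diameter (U i) powr s)) | U :: nat \<Rightarrow> 'a set.
            E \<subseteq> (\<Union>i. U i) \<and> (\<forall>i. bounded (U i) \<and> diameter (U i) \<in> D)}"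

definition diam_hausdorff_dim :: "real set \<Rightarrow> 'a::euclidean_space set \<Rightarrow> real" where
  "diam_hausdorff_dim D E = Inf {s. 0 \<le> s \<and> diam_content D s E = 0}"

text \<open>The usual gauge \<open>|U|\<^sup>s\<close>, with \<open>|U|\<^sup>0 = 1\<close> for nonempty \<open>U\<close> and \<open>|{}|\<^sup>s = 0\<close>
  (note that \<open>0 powr 0 = 0\<close>).\<close>

definition diam_power :: "real \<Rightarrow> 'a::metric_space set \<Rightarrow> ennreal" where
  "diam_power s U =
     (if U = {} then 0 else if s = 0 then 1 else ennreal (diameter U powr s))"

definition hausdorff_premeasure ::
    "real \<Rightarrow> real \<Rightarrow> 'a::euclidean_space set \<Rightarrow> ennreal" where
  "hausdorff_premeasure \<delta> s E =
     Inf {(\<Sum>i. diam_power s (U i)) | U :: nat \<Rightarrow> 'a set.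
            E \<subseteq> (\<Union>i. U i) \<and> (\<forall>i. bounded (U i) \<and> diameter (U i) \<le> \<delta>)}"

definition hausdorff_measure :: "real \<Rightarrow> 'a::euclidean_space set \<Rightarrow> ennreal" where
  "hausdorff_measure s E = (SUP \<delta>\<in>{0<..}. hausdorff_premeasure \<delta> s E)"

definition hausdorff_dim :: "'a::euclidean_space set \<Rightarrow> real" where
  "hausdorff_dim E = Inf {s. 0 \<le> s \<and> hausdorff_measure s E = 0}"

text \<open>A packing is a countable family of disjoint closed balls, given as (centre, radius) pairs,
  with centres in \<open>E\<close>.\<close>

definition packings :: "real \<Rightarrow> 'a::euclidean_space set \<Rightarrow> ('a \<times> real) set set" where
  "packings \<delta> E = {P. countable P \<and> (\<forall>(x, r)\<in>P. x \<in> E \<and> 0 < r \<and> r \<le> \<delta>) \<and>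
     disjoint_family_on (\<lambda>(x, r). cball x r) P}"

definition packing_premeasure :: "real \<Rightarrow> 'a::euclidean_space set \<Rightarrow> ennreal" where
  "packing_premeasure s E =
     (INF \<delta>\<in>{0<..}. SUP P\<in>packings \<delta> E.
        (\<Sum>\<^sub>\<infinity>(x, r)\<in>P. ennreal (diameter (cball x r) powr s)))"

definition packing_measure :: "real \<Rightarrow> 'a::euclidean_space set \<Rightarrow> ennreal" where
  "packing_measure s E =
     Inf {(\<Sum>i. packing_premeasure s (U i)) | U :: nat \<Rightarrow> 'a set. E \<subseteq> (\<Union>i. U i)}"

definition packing_dim :: "'a::euclidean_space set \<Rightarrow> real" where
  "packing_dim E = Inf {s. 0 \<le> s \<and> packing_measure s E = 0}"

section \<open>Sets of binary expansions with restricted positions\<close>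

definition digit_set :: "nat set \<Rightarrow> real set" where
  "digit_set S = {(\<Sum>\<^sub>\<infinity>i\<in>S. x i / 2 ^ i) | x :: nat \<Rightarrow> real. \<forall>i\<in>S. x i \<in> {0, 1}}"

end

theory Submission
  imports Defs
begin

text \<open>
  Write \<open>A\<close> for the digit set, \<open>d n\<close> for the number of free digit positions among the first \<open>n\<close>,
  and \<open>\<rho> n = d n / n\<close>. At scale \<open>2\<^sup>-\<^sup>n\<close> the set \<open>A\<close> is as homogeneous as possible: it consists of
  \<open>2 ^ d n\<close> pieces of diameter at most \<open>2\<^sup>-\<^sup>n\<close>, all carrying the same mass \<open>2\<^sup>-\<^sup>d\<^sup>n\<close> of
  the uniform measure on digit sequences. Hence a cover by sets whose diameters lie in \<open>D\<close> cannot
  do essentially better than the cover by all pieces at one scale, and every dimension is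
  determined by \<open>\<rho>\<close> alone:

  \<^item> the dimension for the family \<open>D\<close> is the lower limit of \<open>\<rho> n\<close> along those \<open>n\<close> for which \<open>D\<close> meets
    \<open>[2\<^sup>-\<^sup>n, 2\<^sup>1\<^sup>-\<^sup>n)\<close> (\<open>diam_hausdorff_dim_digit_set\<close>);
  \<^item> the Hausdorff dimension is the case \<open>D = (0, \<infinity>)\<close>, so it is the lower limit of \<open>\<rho>\<close>
    (\<open>hausdorff_dim_eq_diam_hausdorff_dim\<close>);
  \<^item> the packing dimension is the upper limit of \<open>\<rho>\<close> (\<open>packing_dim_digit_set\<close>).

  One inclusion follows, because lower limits along infinite sets lie between the lower and the
  upper limit. For the other one, note that consecutive values of \<open>\<rho>\<close> differ by at most
  \<open>1 / (n + 1)\<close>. So \<open>\<rho>\<close> cannot keep jumping over a number between its lower and upper limit without coming close to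
  it, every such number \<open>c\<close> is the limit of \<open>\<rho>\<close> along some infinite \<open>M\<close> (\<open>lower_density_along_attains\<close>), and
  the union of the intervals \<open>[2\<^sup>-\<^sup>n, 2\<^sup>1\<^sup>-\<^sup>n)\<close> over \<open>n \<in> M\<close> is an admissible \<open>D\<close> with dimension \<open>c\<close>.

  The uniform measure itself is never constructed. Where a lower bound needs it, Lebesgue measure
  is pulled back along the map \<open>spread S\<close> from \<open>[0, 1)\<close> to \<open>A\<close> that writes the binary digits of its argument
  into the free positions; it moves points at distance several times \<open>2\<^sup>-\<^sup>d\<^sup>n\<close> to points at distance
  at least \<open>2\<^sup>-\<^sup>n\<close> (\<open>spread_expands\<close>). Where an upper bound for packings needs it, counting
  finite digit strings suffices (\<open>digit_set_packing_bound\<close>).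
\<close>

section \<open>Binary expansions\<close>

definition binval :: "nat set \<Rightarrow> real" where
  "binval X = (\<Sum>\<^sub>\<infinity>i\<in>X. (1/2) ^ i)"

lemma summable_on_half_powers: "(\<lambda>i. (1/2::real) ^ i) summable_on X"
proof -
  have "(\<lambda>i::nat. (1/2::real) ^ i) summable_on UNIV"
    by (rule norm_summable_imp_summable_on) (simp add: summable_geometric)
  then show ?thesis
    by (rule summable_on_subset_banach) simp
qed

lemma digit_set_eq_binval: "digit_set S = {binval X | X. X \<subseteq> S}"
proof (intro equalityI subsetI)
  fix y assume "y \<in> digit_set S"
  then obtain x :: "nat \<Rightarrow> real" where x: "\<forall>i\<in>S. x i \<in> {0, 1}" and y: "y = (\<Sum>\<^sub>\<infinity>i\<in>S. x i / 2 ^ i)"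
    unfolding digit_set_def by blast
  have "y = binval {i\<in>S. x i = 1}"
    unfolding y binval_def
    by (rule infsum_cong_neutral) (use x in \<open>auto simp: power_one_over\<close>)
  then show "y \<in> {binval X | X. X \<subseteq> S}" by blast
next
  fix y assume "y \<in> {binval X | X. X \<subseteq> S}"
  then obtain X where X: "X \<subseteq> S" and y: "y = binval X" by blast
  have "y = (\<Sum>\<^sub>\<infinity>i\<in>S. of_bool (i \<in> X) / 2 ^ i)"
    unfolding y binval_def
    by (rule infsum_cong_neutral) (use X in \<open>auto simp: power_one_over\<close>)
  then show "y \<in> digit_set S"
    unfolding digit_set_def by (intro CollectI exI[of _ "\<lambda>i. of_bool (i \<in> X)"]) auto
qed

text \<open>The head of an expansion is a dyadic rational and its tail is at most \<open>2\<^sup>-\<^sup>n\<close>. Two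
  points that share their first \<open>n\<close> digits are therefore \<open>2\<^sup>-\<^sup>n\<close>-close.\<close>

lemma binval_split: "binval X = binval (X \<inter> {..n}) + binval (X \<inter> {n<..})"
proof -
  have "binval ((X \<inter> {..n}) \<union> (X \<inter> {n<..})) = binval (X \<inter> {..n}) + binval (X \<inter> {n<..})"
    unfolding binval_def by (intro infsum_Un_disjoint summable_on_half_powers) auto
  moreover have "(X \<inter> {..n}) \<union> (X \<inter> {n<..}) = X" by auto
  ultimately show ?thesis by simp
qed

lemma binval_nonneg: "0 \<le> binval X"
  unfolding binval_def by (intro infsum_nonneg) auto

lemma binval_UNIV: "binval UNIV = 2"
proof -
  have "((\<lambda>i. (1/2::real) ^ i) has_sum 2) UNIV"
    using geometric_sums[of "1/2::real"]
    by (intro norm_summable_imp_has_sum) (auto simp: summable_geometric)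
  then show ?thesis unfolding binval_def by (rule infsumI)
qed

lemma binval_greaterThan: "binval {n<..} = (1/2) ^ n"
proof -
  have "binval {..n} = 2 - (1/2) ^ n"
    by (induction n) (simp_all add: binval_def atMost_Suc)
  then show ?thesis
    using binval_split[of UNIV n] binval_UNIV by simp
qed

lemma binval_tail_le: "binval (X \<inter> {n<..}) \<le> (1/2) ^ n"
proof -
  have "binval (X \<inter> {n<..}) \<le> binval {n<..}"
    unfolding binval_def by (intro infsum_mono_neutral summable_on_half_powers) auto
  then show ?thesis by (simp add: binval_greaterThan)
qed

text \<open>Position \<open>0\<close> is ignored, since all digits of interest stand behind the binary point.
  For positive positions, and up to the ambiguity of dyadic rationals, this is the integer part of \<open>2 ^ n * binval X\<close>, but unlike
  that integer part it depends on finitely many digits only.\<close>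

primrec binprefix :: "nat set \<Rightarrow> nat \<Rightarrow> int" where
  "binprefix X 0 = 0"
| "binprefix X (Suc n) = 2 * binprefix X n + of_bool (Suc n \<in> X)"

lemma binval_atMost_eq_binprefix:
  assumes "X \<subseteq> {1..}"
  shows "binval (X \<inter> {..n}) = binprefix X n / 2 ^ n"
proof (induction n)
  case 0
  have "X \<inter> {..0} = {}" using assms by auto
  then show ?case by (simp add: binval_def)
next
  case (Suc n)
  show ?case
  proof (cases "Suc n \<in> X")
    case True
    then have "X \<inter> {..Suc n} = insert (Suc n) (X \<inter> {..n})" by auto
    then have "binval (X \<inter> {..Suc n}) = (1/2) ^ Suc n + binval (X \<inter> {..n})"
      by (simp add: binval_def)
    then show ?thesis using Suc True by (simp add: field_simps power_one_over)
  next
    case False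
    then have "X \<inter> {..Suc n} = X \<inter> {..n}" by (auto simp: le_Suc_eq)
    then show ?thesis using Suc False by simp
  qed
qed

lemma binval_prefix_bounds:
  assumes "X \<subseteq> {1..}"
  shows "binprefix X n \<le> 2 ^ n * binval X" "2 ^ n * binval X \<le> binprefix X n + 1"
proof -
  have "2 ^ n * binval X = binprefix X n + 2 ^ n * binval (X \<inter> {n<..})"
    using binval_split[of X n] binval_atMost_eq_binprefix[OF assms, of n]
    by (simp add: field_simps)
  moreover have "2 ^ n * binval (X \<inter> {n<..}) \<le> 1"
    using binval_tail_le[of X n] by (simp add: field_simps power_one_over)
  ultimately show "binprefix X n \<le> 2 ^ n * binval X" "2 ^ n * binval X \<le> binprefix X n + 1"
    using binval_nonneg[of "X \<inter> {n<..}"] by auto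
qed

section \<open>Spreading the unit interval over the digit set\<close>

definition digit_count :: "nat set \<Rightarrow> nat \<Rightarrow> nat" where
  "digit_count S n = card (S \<inter> {..n})"

lemma digit_count_Suc: "digit_count S (Suc n) = digit_count S n + of_bool (Suc n \<in> S)"
proof -
  have "S \<inter> {..Suc n} = (if Suc n \<in> S then insert (Suc n) (S \<inter> {..n}) else S \<inter> {..n})"
    by (auto simp: le_Suc_eq)
  then show ?thesis by (simp add: digit_count_def)
qed

lemma digit_count_0: "S \<subseteq> {1..} \<Longrightarrow> digit_count S 0 = 0"
proof -
  assume "S \<subseteq> {1..}"
  then have "S \<inter> {..0} = {}" by auto
  then show ?thesis by (simp add: digit_count_def)
qed

lemma digit_count_le: "S \<subseteq> {1..} \<Longrightarrow> digit_count S n \<le> n"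
  by (induction n) (auto simp: digit_count_0 digit_count_Suc)

text \<open>For \<open>i \<in> S\<close>, position \<open>i\<close> receives binary digit number \<open>digit_count S i\<close> of \<open>t\<close>, which is the parity
  of the integer part of \<open>2 ^ digit_count S i * t\<close>.\<close>

definition spread_digits :: "nat set \<Rightarrow> real \<Rightarrow> nat set" where
  "spread_digits S t = {i\<in>S. odd \<lfloor>2 ^ digit_count S i * t\<rfloor>}"

lemma floor_double: "\<lfloor>2 * y\<rfloor> = 2 * \<lfloor>y\<rfloor> + of_bool (odd \<lfloor>2 * y\<rfloor>)" for y :: real
proof -
  have "\<lfloor>2 * y\<rfloor> = 2 * \<lfloor>y\<rfloor> \<or> \<lfloor>2 * y\<rfloor> = 2 * \<lfloor>y\<rfloor> + 1" by linarith
  then show ?thesis by auto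
qed

text \<open>Both sides read off integers from the leading digits of \<open>t\<close> and \<open>u\<close>. At a position in \<open>S\<close> both
  integers are doubled and receive the same new digit, while at any other position only the right-hand
  one is doubled; so a nonnegative difference on the left stays below the one on the right.\<close>

lemma floor_diff_le_binprefix_diff:
  assumes S: "S \<subseteq> {1..}" and t: "t \<in> {0..<1}" and u: "u \<in> {0..<1}"
    and le: "\<lfloor>2 ^ digit_count S n * t\<rfloor> \<le> \<lfloor>2 ^ digit_count S n * u\<rfloor>"
  shows "\<lfloor>2 ^ digit_count S n * u\<rfloor> - \<lfloor>2 ^ digit_count S n * t\<rfloor>
    \<le> binprefix (spread_digits S u) n - binprefix (spread_digits S t) n"
  using le
proof (induction n)
  case 0
  have "\<lfloor>t\<rfloor> = 0" "\<lfloor>u\<rfloor> = 0" using t u by (auto simp: floor_eq_iff)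
  then show ?case by (simp add: digit_count_0[OF S])
next
  case (Suc n)
  show ?case
  proof (cases "Suc n \<in> S")
    case True
    have *: "\<lfloor>2 ^ digit_count S (Suc n) * v\<rfloor>
        = 2 * \<lfloor>2 ^ digit_count S n * v\<rfloor> + of_bool (Suc n \<in> spread_digits S v)" for v
      using floor_double[of "2 ^ digit_count S n * v"] True
      by (simp add: digit_count_Suc spread_digits_def mult.assoc)
    have "\<lfloor>2 ^ digit_count S n * t\<rfloor> \<le> \<lfloor>2 ^ digit_count S n * u\<rfloor>"
      using Suc.prems unfolding * by (auto simp: of_bool_def split: if_splits)
    from Suc.IH[OF this] show ?thesis unfolding * by simp
  next
    case False
    then have "digit_count S (Suc n) = digit_count S n"
      "Suc n \<notin> spread_digits S t" "Suc n \<notin> spread_digits S u"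
      by (auto simp: digit_count_Suc spread_digits_def)
    with Suc show ?thesis by auto
  qed
qed

definition spread :: "nat set \<Rightarrow> real \<Rightarrow> real" where
  "spread S t = binval (spread_digits S t)"

lemma spread_in_digit_set: "spread S t \<in> digit_set S"
  unfolding digit_set_eq_binval spread_def spread_digits_def by blast

text \<open>If \<open>t\<close> and \<open>u\<close> are at least two dyadic intervals of length \<open>2\<^sup>-\<^sup>d\<^sup>n\<close> apart, then their images are
  \<open>2\<^sup>-\<^sup>n\<close> apart. Adjacent intervals may have arbitrarily close images, which is the reason for
  the summand \<open>- 1\<close>.\<close>

lemma spread_expands:
  assumes S: "S \<subseteq> {1..}" and t: "t \<in> {0..<1}" and u: "u \<in> {0..<1}"
    and le: "\<lfloor>2 ^ digit_count S n * t\<rfloor> \<le> \<lfloor>2 ^ digit_count S n * u\<rfloor>"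
  shows "\<lfloor>2 ^ digit_count S n * u\<rfloor> - \<lfloor>2 ^ digit_count S n * t\<rfloor> - 1
    \<le> 2 ^ n * (spread S u - spread S t)"
proof -
  have sub: "spread_digits S v \<subseteq> {1..}" for v
    using S by (auto simp: spread_digits_def)
  have "real_of_int (\<lfloor>2 ^ digit_count S n * u\<rfloor> - \<lfloor>2 ^ digit_count S n * t\<rfloor>)
    \<le> real_of_int (binprefix (spread_digits S u) n - binprefix (spread_digits S t) n)"
    using floor_diff_le_binprefix_diff[OF assms] unfolding of_int_le_iff .
  then show ?thesis
    using binval_prefix_bounds[OF sub[of t], of n] binval_prefix_bounds[OF sub[of u], of n]
    by (simp add: spread_def algebra_simps)
qed

text \<open>The mass distribution principle: a set of diameter at most \<open>2 * 2\<^sup>-\<^sup>N\<close> has a preimage under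
  \<open>spread S\<close> of diameter at most \<open>4 * 2\<^sup>-\<^sup>d\<^sup>N\<close>, and the preimages of a cover have to fill the unit
  interval.\<close>

lemma digit_set_mass_bound:
  assumes S: "S \<subseteq> {1..}" and cover: "digit_set S \<subseteq> (\<Union>i. U i)"
    and small: "\<And>i x y. x \<in> U i \<Longrightarrow> y \<in> U i \<Longrightarrow> \<bar>x - y\<bar> \<le> 2 / 2 ^ N i"
  shows "1 \<le> (\<Sum>i. ennreal (8 / 2 ^ digit_count S (N i)))"
proof -
  define V where "V i = {t\<in>{0..<1::real}. spread S t \<in> U i}" for i
  have close: "\<bar>u - t\<bar> \<le> 4 / 2 ^ digit_count S (N i)" if "t \<in> V i" "u \<in> V i" for i t u
  proof -
    let ?d = "digit_count S (N i)"
    have main: "\<bar>u - t\<bar> \<le> 4 / 2 ^ ?d"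
      if tu: "t \<in> V i" "u \<in> V i" and le: "\<lfloor>2 ^ ?d * t\<rfloor> \<le> \<lfloor>2 ^ ?d * u\<rfloor>" for t u
    proof -
      have "\<lfloor>2 ^ ?d * u\<rfloor> - \<lfloor>2 ^ ?d * t\<rfloor> - 1 \<le> 2 ^ N i * (spread S u - spread S t)"
        using tu le by (intro spread_expands[OF S]) (auto simp: V_def)
      also have "\<dots> \<le> 2"
        using small[of "spread S u" i "spread S t"] tu by (auto simp: V_def field_simps abs_le_iff)
      \<comment> \<open>The integer parts differ by at most \<open>3\<close>.\<close>
      finally have "\<bar>2 ^ ?d * u - 2 ^ ?d * t\<bar> \<le> 4"
        using le by linarith
      then have "2 ^ ?d * \<bar>u - t\<bar> \<le> 4"
        by (simp add: abs_mult flip: right_diff_distrib)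
      then show ?thesis by (simp add: field_simps)
    qed
    from main[OF that] main[OF that(2,1)] show ?thesis
      by (metis abs_minus_commute linear)
  qed
  have "\<exists>W. V i \<subseteq> W \<and> W \<in> sets lborel \<and> emeasure lborel W \<le> ennreal (8 / 2 ^ digit_count S (N i))" for i
  proof (cases "V i = {}")
    case True
    then show ?thesis by (intro exI[of _ "{}"]) auto
  next
    case False
    then obtain t where t: "t \<in> V i" by blast
    let ?e = "4 / 2 ^ digit_count S (N i) :: real"
    have "V i \<subseteq> {t - ?e..t + ?e}"
      using close[OF t] by (auto simp: abs_le_iff algebra_simps)
    moreover have "emeasure lborel {t - ?e..t + ?e} = ennreal (8 / 2 ^ digit_count S (N i))"
      by (subst emeasure_lborel_Icc) auto
    ultimately show ?thesis by (intro exI[of _ "{t - ?e..t + ?e}"]) auto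
  qed
  then obtain W where W: "\<And>i. V i \<subseteq> W i" "\<And>i. W i \<in> sets lborel"
      "\<And>i. emeasure lborel (W i) \<le> ennreal (8 / 2 ^ digit_count S (N i))"
    by metis
  have "{0..<1} \<subseteq> (\<Union>i. V i)"
    using cover spread_in_digit_set[of S] unfolding V_def by fastforce
  also have "\<dots> \<subseteq> (\<Union>i. W i)" using W(1) by blast
  finally have "{0..<1} \<subseteq> (\<Union>i. W i)" .
  then have "emeasure lborel {0..<1::real} \<le> emeasure lborel (\<Union>i. W i)"
    by (intro emeasure_mono) (use W(2) in auto)
  then have "1 \<le> emeasure lborel (\<Union>i. W i)" by simp
  also have "\<dots> \<le> (\<Sum>i. emeasure lborel (W i))"
    by (rule emeasure_subadditive_countably) (use W(2) in auto)
  also have "\<dots> \<le> (\<Sum>i. ennreal (8 / 2 ^ digit_count S (N i)))"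
    by (intro suminf_le W(3) summableI)
  finally show ?thesis .
qed

section \<open>Covers and packings by cylinders\<close>

lemma digit_set_cylinder_cover:
  "digit_set S \<subseteq> (\<Union>T\<in>Pow (S \<inter> {..n}). {binval T..binval T + (1/2) ^ n})"
proof
  fix x assume "x \<in> digit_set S"
  then obtain X where X: "X \<subseteq> S" "x = binval X" unfolding digit_set_eq_binval by blast
  then show "x \<in> (\<Union>T\<in>Pow (S \<inter> {..n}). {binval T..binval T + (1/2) ^ n})"
    using binval_split[of X n] binval_tail_le[of X n] binval_nonneg[of "X \<inter> {n<..}"]
    by (intro UN_I[of "X \<inter> {..n}"]) auto
qed

text \<open>Counting replaces the uniform measure. Let \<open>M\<close> be the finest scale that occurs. A ball of radius
  at least \<open>2\<^sup>-\<^sup>n\<close> about a point of the digit set contains every point that shares the first \<open>n\<close> digits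
  with the centre, hence \<open>2 ^ (d M - d n)\<close> of the \<open>2 ^ d M\<close> digit strings of length \<open>M\<close>. Disjoint balls
  contain disjoint sets of digit strings.\<close>

lemma digit_set_packing_bound:
  assumes P: "finite P" and centre: "\<And>x r. (x, r) \<in> P \<Longrightarrow> x \<in> digit_set S"
    and disj: "disjoint_family_on (\<lambda>(x, r). cball x r) P"
    and big: "\<And>x r. (x, r) \<in> P \<Longrightarrow> (1/2) ^ N (x, r) \<le> r"
  shows "(\<Sum>p\<in>P. 1 / 2 ^ digit_count S (N p) :: real) \<le> 1"
proof -
  define M where "M = Max (insert 0 (N ` P))"
  have NM: "N p \<le> M" if "p \<in> P" for p
    using P that by (auto simp: M_def)
  define F where "F p = {T \<in> Pow (S \<inter> {..M}). binval T \<in> cball (fst p) (snd p)}" for p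
  have fin: "finite (F p)" for p unfolding F_def by auto
  have card_F: "2 ^ (digit_count S M - digit_count S (N p)) \<le> card (F p)" if p: "p \<in> P" for p
  proof -
    obtain x r where xr: "p = (x, r)" by (cases p)
    obtain X where X: "X \<subseteq> S" "x = binval X"
      using centre p unfolding xr digit_set_eq_binval by blast
    let ?n = "N p"
    let ?f = "\<lambda>W. (X \<inter> {..?n}) \<union> W"
    have "?f ` Pow (S \<inter> {?n<..M}) \<subseteq> F p"
    proof
      fix T assume "T \<in> ?f ` Pow (S \<inter> {?n<..M})"
      then obtain W where W: "W \<subseteq> S \<inter> {?n<..M}" "T = (X \<inter> {..?n}) \<union> W" by blast
      have "T \<in> Pow (S \<inter> {..M})" using W X NM[OF p] by auto
      moreover have "T \<inter> {..?n} = X \<inter> {..?n}" using W by auto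
      then have "\<bar>binval T - x\<bar> \<le> (1/2) ^ ?n"
        using binval_split[of T ?n] binval_split[of X ?n] X
          binval_tail_le[of T ?n] binval_nonneg[of "T \<inter> {?n<..}"]
          binval_tail_le[of X ?n] binval_nonneg[of "X \<inter> {?n<..}"]
        by (auto simp: abs_le_iff)
      ultimately show "T \<in> F p"
        using big[of x r] p by (auto simp: F_def xr dist_real_def)
    qed
    then have "card (?f ` Pow (S \<inter> {?n<..M})) \<le> card (F p)"
      by (rule card_mono[OF fin])
    moreover have "inj_on ?f (Pow (S \<inter> {?n<..M}))"
    proof (rule inj_on_inverseI)
      show "?f W \<inter> {?n<..} = W" if "W \<in> Pow (S \<inter> {?n<..M})" for W
        using that by auto
    qed
    then have "card (?f ` Pow (S \<inter> {?n<..M})) = 2 ^ card (S \<inter> {?n<..M})"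
      by (simp add: card_image card_Pow del: Pow_Int_eq)
    moreover have "card (S \<inter> {?n<..M}) = digit_count S M - digit_count S ?n"
    proof -
      have "S \<inter> {?n<..M} = (S \<inter> {..M}) - (S \<inter> {..?n})" using NM[OF p] by auto
      moreover have "S \<inter> {..?n} \<subseteq> S \<inter> {..M}" using NM[OF p] by auto
      ultimately show ?thesis by (simp add: digit_count_def card_Diff_subset)
    qed
    ultimately show ?thesis by simp
  qed
  have mono: "digit_count S (N p) \<le> digit_count S M" if "p \<in> P" for p
    unfolding digit_count_def using NM[OF that] by (intro card_mono) auto
  have "(\<Sum>p\<in>P. 2 ^ digit_count S M / 2 ^ digit_count S (N p) :: real)
      = (\<Sum>p\<in>P. real (2 ^ (digit_count S M - digit_count S (N p))))"
    unfolding of_nat_power of_nat_numeral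
    by (intro sum.cong refl) (use mono in \<open>simp add: power_diff\<close>)
  also have "\<dots> \<le> (\<Sum>p\<in>P. real (card (F p)))"
    by (intro sum_mono) (use card_F of_nat_le_iff in blast)
  also have "\<dots> = real (card (\<Union>p\<in>P. F p))"
  proof -
    have "F p \<inter> F q = {}" if "p \<in> P" "q \<in> P" "p \<noteq> q" for p q
    proof -
      have "cball (fst p) (snd p) \<inter> cball (fst q) (snd q) = {}"
        using disj that unfolding disjoint_family_on_def by (auto simp: case_prod_beta)
      then show ?thesis unfolding F_def by blast
    qed
    then show ?thesis using P fin by (simp add: card_UN_disjoint)
  qed
  also have "\<dots> \<le> real (card (Pow (S \<inter> {..M})))"
    by (intro of_nat_mono card_mono) (auto simp: F_def)
  also have "\<dots> = 2 ^ digit_count S M"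
    by (simp add: card_Pow digit_count_def del: Pow_Int_eq)
  finally have "2 ^ digit_count S M * (\<Sum>p\<in>P. 1 / 2 ^ digit_count S (N p) :: real) \<le> 2 ^ digit_count S M * 1"
    by (simp add: sum_distrib_left)
  then show ?thesis by (subst (asm) mult_le_cancel_left_pos) auto
qed

section \<open>Densities of the free positions\<close>

definition digit_density :: "nat set \<Rightarrow> nat \<Rightarrow> real" where
  "digit_density S n = digit_count S n / n"

text \<open>For infinite \<open>M\<close>, this is the lower limit of the density along \<open>M\<close>, and the next definition is
  the upper limit. Both are written as infima of the same shape as the definitions of the
  dimensions, so that they can be compared one exponent at a time.\<close>

definition lower_density_along :: "nat set \<Rightarrow> nat set \<Rightarrow> real" where
  "lower_density_along M S =
     Inf {s. 0 \<le> s \<and> (\<exists>\<^sub>F n in sequentially. n \<in> M \<and> digit_density S n < s)}"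

definition upper_density :: "nat set \<Rightarrow> real" where
  "upper_density S = Inf {s. 0 \<le> s \<and> (\<forall>\<^sub>F n in sequentially. digit_density S n < s)}"

lemma digit_density_nonneg: "0 \<le> digit_density S n"
  by (simp add: digit_density_def)

lemma digit_density_le_1: "S \<subseteq> {1..} \<Longrightarrow> digit_density S n \<le> 1"
  using digit_count_le[of S n] by (auto simp: digit_density_def divide_le_eq)

lemma digit_density_less_iff:
  fixes s :: real
  shows "0 < n \<Longrightarrow> digit_density S n < s \<longleftrightarrow> digit_count S n < s * n"
  by (simp add: digit_density_def field_simps)

lemma half_power_powr:
  fixes s :: real
  shows "((1/2) ^ n) powr s = 2 powr (- s * n)"
proof -
  have "((1/2::real) ^ n) = 2 powr (- n)"
    by (simp add: powr_minus_divide powr_realpow power_one_over)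
  then show ?thesis by (simp add: powr_powr mult.commute)
qed

text \<open>Critical exponents agree as soon as each membership passes to the other set at every strictly
  larger exponent. The positive gap between the exponents is what absorbs all constants
  below.\<close>

lemma Inf_le_Inf_if_slack:
  fixes A B :: "real set"
  assumes "A \<noteq> {}" "bdd_below B" "\<And>a s. a \<in> A \<Longrightarrow> a < s \<Longrightarrow> s \<in> B"
  shows "Inf B \<le> Inf A"
proof (rule cInf_greatest[OF assms(1)])
  fix a assume a: "a \<in> A"
  show "Inf B \<le> a"
    by (rule dense_ge) (use assms(2,3) a in \<open>auto intro: cInf_lower\<close>)
qed

lemma Inf_eq_if_slack:
  assumes "A \<subseteq> {0..}" "B \<subseteq> {0..}"
    and AB: "\<And>a s. a \<in> A \<Longrightarrow> a < s \<Longrightarrow> s \<in> B" and BA: "\<And>b s. b \<in> B \<Longrightarrow> b < s \<Longrightarrow> s \<in> A"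
  shows "Inf A = (Inf B :: real)"
proof (cases "A = {} \<or> B = {}")
  case True
  have "a + 1 \<in> B" if "a \<in> A" for a using AB[OF that, of "a + 1"] by simp
  moreover have "b + 1 \<in> A" if "b \<in> B" for b using BA[OF that, of "b + 1"] by simp
  ultimately have "A = B" using True by blast
  then show ?thesis by simp
next
  case False
  have "bdd_below A" "bdd_below B" using assms(1,2) by (auto intro: bdd_belowI[of _ 0])
  moreover have "A \<noteq> {}" "B \<noteq> {}" using False by auto
  ultimately show ?thesis
    by (meson AB BA antisym Inf_le_Inf_if_slack)
qed

section \<open>The dimension for a family of admissible diameters\<close>

lemma dyadic_scale_exists:
  assumes "0 < r" "r < (2::real)"
  shows "\<exists>n. (1/2) ^ n \<le> r \<and> r < 2 * (1/2) ^ n"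
proof -
  define n where "n = (LEAST n. (1/2) ^ n \<le> r)"
  obtain k where "(1/2) ^ k < r" using assms real_arch_pow_inv[of r "1/2"] by auto
  then have n: "(1/2) ^ n \<le> r"
    unfolding n_def by (intro LeastI[of "\<lambda>n. (1/2) ^ n \<le> r" k]) simp
  moreover have "r < 2 * (1/2) ^ n"
  proof (cases n)
    case (Suc m)
    then have "\<not> (1/2) ^ m \<le> r"
      using not_less_Least[of m "\<lambda>n. (1/2) ^ n \<le> r"] unfolding n_def by simp
    with Suc show ?thesis by simp
  qed (use assms in simp)
  ultimately show ?thesis by blast
qed

definition dyadic_scales :: "real set \<Rightarrow> nat set" where
  "dyadic_scales D = {n. D \<inter> {(1/2) ^ n..<2 * (1/2) ^ n} \<noteq> {}}"

lemma diam_family_small_element: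
  assumes "D \<in> diam_families" "0 < e"
  obtains r where "r \<in> D" "0 < r" "r < e"
proof -
  have "D \<noteq> {}" "Inf D < e" "D \<subseteq> {0<..}"
    using assms by (auto simp: diam_families_def)
  then show ?thesis using cInf_lessD[of D e] that by auto
qed

lemma half_power_less_imp: "(1/2::real) ^ m < (1/2) ^ n \<Longrightarrow> n < m"
  by simp

lemma frequently_dyadic_scales:
  assumes "D \<in> diam_families"
  shows "\<exists>\<^sub>F n in sequentially. n \<in> dyadic_scales D"
  unfolding frequently_sequentially
proof
  fix N
  obtain r where r: "r \<in> D" "0 < r" "r < (1/2) ^ N"
    using diam_family_small_element[OF assms, of "(1/2) ^ N"] by auto
  have "(1/2::real) ^ N \<le> 1" by (simp add: power_le_one)
  with r obtain n where n: "(1/2) ^ n \<le> r" "r < 2 * (1/2) ^ n"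
    using dyadic_scale_exists[of r] by auto
  have "N < n"
    using le_less_trans[OF n(1) r(3)] by (rule half_power_less_imp)
  moreover have "n \<in> dyadic_scales D" using n r by (auto simp: dyadic_scales_def)
  ultimately show "\<exists>n\<ge>N. n \<in> dyadic_scales D" by (meson less_imp_le)
qed

lemma suminf_half_powers_ennreal: "0 \<le> e \<Longrightarrow> (\<Sum>i. ennreal (e * (1/2) ^ Suc i)) = ennreal e"
  using sums_mult[OF power_half_series, of e] by (intro suminf_ennreal_eq) auto

text \<open>The content asks for infinite covers by sets of positive diameter. A finite cover is padded
  with sets of admissible diameters whose powers have an arbitrarily small sum; such diameters exist
  because \<open>Inf D = 0\<close>.\<close>

lemma diam_content_le_finite_cover:
  fixes E :: "'a::euclidean_space set"
  assumes D: "D \<in> diam_families" and s: "0 < s" and J: "finite J" and E: "E \<subseteq> (\<Union>j\<in>J. U j)"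
    and U: "\<And>j. j \<in> J \<Longrightarrow> bounded (U j) \<and> diameter (U j) \<in> D"
  shows "diam_content D s E \<le> (\<Sum>j\<in>J. ennreal (diameter (U j) powr s))"
proof (rule ennreal_le_epsilon)
  fix e :: real assume e: "0 < e"
  obtain h where h: "bij_betw h {..<card J} J"
    using ex_bij_betw_nat_finite[OF J] by (auto simp: atLeast0LessThan)
  have "\<exists>r\<in>D. 0 < r \<and> r powr s \<le> e * (1/2) ^ Suc i" for i
  proof -
    let ?c = "e * (1/2) ^ Suc i"
    have c: "0 < ?c" using e by simp
    then have "0 < ?c powr (1/s)" unfolding powr_gt_zero by linarith
    then obtain r where r: "r \<in> D" "0 < r" "r < ?c powr (1/s)"
      by (rule diam_family_small_element[OF D])
    then have "r powr s \<le> (?c powr (1/s)) powr s" using s by (intro powr_mono2) auto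
    also have "\<dots> = ?c" using s c by (simp add: powr_powr)
    finally show ?thesis using r by blast
  qed
  then obtain r where r: "\<And>i. r i \<in> D" "\<And>i. 0 < r i" "\<And>i. r i powr s \<le> e * (1/2) ^ Suc i"
    by metis
  define V where "V i = (if i < card J then U (h i) else cball 0 (r i / 2))" for i
  have "h i \<in> J" if "i < card J" for i using h that by (auto simp: bij_betw_def)
  then have V: "bounded (V i) \<and> diameter (V i) \<in> D" for i
    using U r[of i] by (auto simp: V_def intro: less_imp_le)
  have "E \<subseteq> (\<Union>i. V i)"
  proof
    fix x assume "x \<in> E"
    then obtain j where "j \<in> J" "x \<in> U j" using E by blast
    moreover from \<open>j \<in> J\<close> have "j \<in> h ` {..<card J}" using h by (simp add: bij_betw_def)
    then obtain i where "i < card J" "h i = j" by auto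
    ultimately show "x \<in> (\<Union>i. V i)" by (auto simp: V_def)
  qed
  with V have "diam_content D s E \<le> (\<Sum>i. ennreal (diameter (V i) powr s))"
    unfolding diam_content_def by (intro Inf_lower) blast
  also have "\<dots> \<le> (\<Sum>i. (if i < card J then ennreal (diameter (U (h i)) powr s) else 0)
      + ennreal (e * (1/2) ^ Suc i))"
    using r by (intro suminf_le summableI) (auto simp: V_def less_imp_le intro!: ennreal_leI)
  also have "\<dots> = (\<Sum>i. if i < card J then ennreal (diameter (U (h i)) powr s) else 0)
      + (\<Sum>i. ennreal (e * (1/2) ^ Suc i))"
    by (rule suminf_add[symmetric]) (rule summableI)+
  also have "(\<Sum>i. if i < card J then ennreal (diameter (U (h i)) powr s) else 0)
      = (\<Sum>i<card J. ennreal (diameter (U (h i)) powr s))"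
    by (subst suminf_finite[of "{..<card J}"]) auto
  also have "\<dots> = (\<Sum>j\<in>J. ennreal (diameter (U j) powr s))"
    by (rule sum.reindex_bij_betw[OF h])
  finally show "diam_content D s E \<le> (\<Sum>j\<in>J. ennreal (diameter (U j) powr s)) + ennreal e"
    using e by (simp only: suminf_half_powers_ennreal[OF less_imp_le])
qed

text \<open>At a scale with \<open>d n < s * n\<close> that \<open>D\<close> meets in \<open>r\<close>, the \<open>2 ^ d n\<close> cylinders are covered by intervals of length
  \<open>r\<close>. The sum of the \<open>s'\<close>-th powers is at most a constant times \<open>2 powr ((s - s') * n)\<close>, which is
  small for large \<open>n\<close>.\<close>

lemma diam_content_digit_set_eq_0:
  assumes D: "D \<in> diam_families" and s: "0 \<le> s" "s < s'"
    and freq: "\<exists>\<^sub>F n in sequentially. n \<in> dyadic_scales D \<and> digit_density S n < s"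
  shows "diam_content D s' (digit_set S) = 0"
proof -
  have "diam_content D s' (digit_set S) \<le> 0 + ennreal e" if e: "0 < e" for e
  proof -
    define b :: real where "b = 2 powr (s - s')"
    have b: "0 < b" "b < 1" using s by (auto simp: b_def powr_less_one)
    have "(\<lambda>n. 2 powr s' * b ^ n) \<longlonglongrightarrow> 2 powr s' * 0"
      using b by (intro tendsto_intros LIMSEQ_power_zero) auto
    then have "\<forall>\<^sub>F n in sequentially. 2 powr s' * b ^ n < e"
      using e by (intro order_tendstoD) auto
    then have "\<forall>\<^sub>F n in sequentially. 2 powr s' * b ^ n < e \<and> 0 < n"
      by (intro eventually_conj eventually_gt_at_top)
    from frequently_eventually_frequently[OF freq this]
    obtain n where n: "n \<in> dyadic_scales D" "digit_density S n < s" "2 powr s' * b ^ n < e" "0 < n"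
      by (auto dest: frequently_ex)
    then obtain r where r: "r \<in> D" "(1/2) ^ n \<le> r" "r < 2 * (1/2) ^ n"
      by (auto simp: dyadic_scales_def)
    have "0 < r" using r(2) by (rule less_le_trans[rotated]) simp
    let ?J = "Pow (S \<inter> {..n})"
    have "diam_content D s' (digit_set S)
        \<le> (\<Sum>T\<in>?J. ennreal (diameter {binval T..binval T + r} powr s'))"
    proof (rule diam_content_le_finite_cover[OF D])
      show "digit_set S \<subseteq> (\<Union>T\<in>?J. {binval T..binval T + r})"
        using digit_set_cylinder_cover[of S n] r(2) by fastforce
    qed (use s r \<open>0 < r\<close> in auto)
    also have "\<dots> = ennreal (2 ^ digit_count S n * r powr s')"
      using \<open>0 < r\<close> by (simp add: card_Pow digit_count_def del: Pow_Int_eq) (simp add: ennreal_mult ennreal_of_nat_eq_real_of_nat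
          flip: ennreal_power)
    also have "\<dots> \<le> ennreal e"
    proof (rule ennreal_leI)
      have "2 ^ digit_count S n \<le> 2 powr (s * n)"
        using n(2,4) by (simp add: digit_density_less_iff flip: powr_realpow)
      moreover have "r powr s' \<le> (2 * (1/2) ^ n) powr s'"
        using r s \<open>0 < r\<close> by (intro powr_mono2) auto
      ultimately have "2 ^ digit_count S n * r powr s' \<le> 2 powr (s * n) * (2 * (1/2) ^ n) powr s'"
        by (intro mult_mono) auto
      also have "\<dots> = 2 powr s' * b ^ n"
        by (simp add: powr_mult half_power_powr b_def powr_power flip: powr_add)
          (simp add: algebra_simps)
      finally show "2 ^ digit_count S n * r powr s' \<le> e" using n(3) by simp
    qed
    finally show ?thesis by simp
  qed
  then have "diam_content D s' (digit_set S) \<le> 0" by (rule ennreal_le_epsilon)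
  then show ?thesis by simp
qed

lemma half_power_digit_count_le:
  fixes s :: real
  assumes "s * n \<le> digit_count S n"
  shows "1 / 2 ^ digit_count S n \<le> ((1/2) ^ n) powr s"
proof -
  have "1 / 2 ^ digit_count S n = 2 powr (- real (digit_count S n))"
    by (simp add: powr_minus_divide powr_realpow)
  also have "\<dots> \<le> ((1/2) ^ n) powr s"
    using assms by (simp add: half_power_powr)
  finally show ?thesis .
qed

lemma ennreal_term_le_suminf: "f i \<le> (\<Sum>i. f i :: ennreal)"
  using sum_le_suminf[OF summableI, of "{i}" f] by simp

text \<open>Let the density bound hold from \<open>n0\<close> on. A cover with a set of diameter at least \<open>2\<^sup>-\<^sup>n\<^sup>0\<close> has a sum
  bounded below for trivial reasons.
  In any other cover each set \<open>U\<close> lives at a scale where its mass bound \<open>2\<^sup>-\<^sup>d\<^sup>n\<close> does not exceed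
  \<open>diameter U powr s\<close>, and the mass bounds add up to at least a constant.\<close>

lemma diam_content_digit_set_pos:
  assumes S: "S \<subseteq> {1..}" and D: "D \<subseteq> {0<..}" and s: "0 \<le> s"
    and ev: "\<forall>\<^sub>F n in sequentially. n \<in> dyadic_scales D \<longrightarrow> s \<le> digit_density S n"
  shows "0 < diam_content D s (digit_set S)"
proof -
  from ev obtain n0 where n0: "\<And>n. n0 \<le> n \<Longrightarrow> n \<in> dyadic_scales D \<Longrightarrow> s \<le> digit_density S n"
    by (auto simp: eventually_sequentially)
  define c :: real where "c = min (1/8) (((1/2) ^ n0) powr s)"
  have "ennreal c \<le> (\<Sum>i. ennreal (diameter (U i) powr s))"
    if cover: "digit_set S \<subseteq> (\<Union>i. U i)" and U: "\<And>i. bounded (U i) \<and> diameter (U i) \<in> D" for U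
  proof (cases "\<exists>i. (1/2) ^ n0 \<le> diameter (U i)")
    case True
    then obtain i where i: "(1/2) ^ n0 \<le> diameter (U i)" by blast
    have "ennreal c \<le> ennreal (diameter (U i) powr s)"
      using powr_mono2[OF s _ i] by (intro ennreal_leI) (auto simp: c_def)
    also have "\<dots> \<le> (\<Sum>i. ennreal (diameter (U i) powr s))"
      by (rule ennreal_term_le_suminf)
    finally show ?thesis .
  next
    case False
    then have small: "diameter (U i) < (1/2) ^ n0" for i by (simp add: not_le)
    have pos: "0 < diameter (U i)" for i using U[of i] D by auto
    have "\<exists>n. (1/2) ^ n \<le> diameter (U i) \<and> diameter (U i) < 2 * (1/2) ^ n" for i
    proof (rule dyadic_scale_exists[OF pos])
      have "(1/2::real) ^ n0 \<le> 1" by (simp add: power_le_one)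
      then show "diameter (U i) < 2" using small[of i] by linarith
    qed
    then obtain N where N: "\<And>i. (1/2) ^ N i \<le> diameter (U i)" "\<And>i. diameter (U i) < 2 * (1/2) ^ N i"
      by metis
    have dens: "s * N i \<le> digit_count S (N i)" for i
    proof -
      have "n0 < N i"
        using le_less_trans[OF N(1) small] by (rule half_power_less_imp)
      moreover have "N i \<in> dyadic_scales D" using N[of i] U[of i] by (auto simp: dyadic_scales_def)
      ultimately show ?thesis
        using n0[of "N i"] digit_density_less_iff[of "N i" S s] by (auto simp: not_less[symmetric])
    qed
    have "1 \<le> (\<Sum>i. ennreal (8 / 2 ^ digit_count S (N i)))"
    proof (rule digit_set_mass_bound[OF S cover])
      show "\<bar>x - y\<bar> \<le> 2 / 2 ^ N i" if "x \<in> U i" "y \<in> U i" for x y i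
        using diameter_bounded_bound[of "U i" x y] U[of i] N(2)[of i] that
        by (simp add: dist_real_def power_one_over)
    qed
    also have "\<dots> \<le> (\<Sum>i. ennreal 8 * ennreal (diameter (U i) powr s))"
    proof (intro suminf_le summableI)
      fix i
      have "1 / 2 ^ digit_count S (N i) \<le> diameter (U i) powr s"
        using half_power_digit_count_le[OF dens[of i]] powr_mono2[OF s _ N(1)[of i]] by simp
      then have "ennreal (8 / 2 ^ digit_count S (N i)) \<le> ennreal (8 * diameter (U i) powr s)"
        by (intro ennreal_leI) simp
      then show "ennreal (8 / 2 ^ digit_count S (N i)) \<le> ennreal 8 * ennreal (diameter (U i) powr s)"
        by (simp add: ennreal_mult)
    qed
    also have "\<dots> = ennreal 8 * (\<Sum>i. ennreal (diameter (U i) powr s))" by simp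
    finally have "ennreal (1/8) * 1 \<le> ennreal (1/8) * (ennreal 8 * (\<Sum>i. ennreal (diameter (U i) powr s)))"
      by (rule mult_left_mono) simp
    also have "\<dots> = ennreal (1/8 * 8) * (\<Sum>i. ennreal (diameter (U i) powr s))"
      unfolding mult.assoc[symmetric] by (subst ennreal_mult) auto
    also have "\<dots> = (\<Sum>i. ennreal (diameter (U i) powr s))" by simp
    finally show ?thesis
      using order_trans[of "ennreal c" "ennreal (1/8)"] by (simp add: c_def ennreal_leI)
  qed
  then have "ennreal c \<le> diam_content D s (digit_set S)"
    unfolding diam_content_def by (intro Inf_greatest) auto
  moreover have "0 < ennreal c" by (simp add: c_def)
  ultimately show ?thesis by (rule less_le_trans[rotated])
qed

lemma diam_hausdorff_dim_digit_set:
  assumes S: "S \<subseteq> {1..}" and D: "D \<in> diam_families"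
  shows "diam_hausdorff_dim D (digit_set S) = lower_density_along (dyadic_scales D) S"
  unfolding diam_hausdorff_dim_def lower_density_along_def
proof (rule Inf_eq_if_slack)
  fix a s :: real
  assume a: "a \<in> {s. 0 \<le> s \<and> diam_content D s (digit_set S) = 0}" and "a < s"
  have "\<exists>\<^sub>F n in sequentially. n \<in> dyadic_scales D \<and> digit_density S n < a"
  proof (rule ccontr)
    assume "\<not> ?thesis"
    then have "\<forall>\<^sub>F n in sequentially. n \<in> dyadic_scales D \<longrightarrow> a \<le> digit_density S n"
      by (simp add: not_frequently not_less)
    with diam_content_digit_set_pos[OF S _ _ this] a D show False
      by (auto simp: diam_families_def)
  qed
  then have "\<exists>\<^sub>F n in sequentially. n \<in> dyadic_scales D \<and> digit_density S n < s"
    by (rule frequently_mono[rotated]) (use \<open>a < s\<close> in auto)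
  with a \<open>a < s\<close> show "s \<in> {s. 0 \<le> s \<and> (\<exists>\<^sub>F n in sequentially. n \<in> dyadic_scales D \<and> digit_density S n < s)}"
    by auto
qed (use diam_content_digit_set_eq_0[OF D] in auto)

section \<open>Hausdorff dimension as a special case\<close>

lemma greaterThan_0_in_diam_families: "{0<..} \<in> diam_families"
  unfolding diam_families_def openin_sorgenfrey_iff by (auto intro!: exI[of _ 1])

lemma small_cover_if_content_0:
  assumes "Inf {F U | U :: 'b. P U} = (0::ennreal)" "0 < e"
  obtains U where "P U" "F U < e"
proof -
  have "Inf {F U | U. P U} < e" using assms by simp
  then show ?thesis using that unfolding Inf_less_iff by blast
qed

text \<open>The content puts no upper bound on the diameters, but if the sum of the powers is small, then
  so is every single diameter.\<close>

lemma hausdorff_measure_eq_0_if_diam_content_eq_0: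
  fixes E :: "'a::euclidean_space set"
  assumes zero: "diam_content {0<..} s E = 0" and s: "0 \<le> s" "s < s'"
  shows "hausdorff_measure s' E = 0"
proof -
  have premeasure: "hausdorff_premeasure \<delta> s' E \<le> 0 + ennreal e" if e: "0 < e" and \<delta>: "0 < \<delta>" for \<delta> e
  proof -
    \<comment> \<open>The second entry forces the diameters below \<open>\<delta>\<close>, and below \<open>1\<close>, where powers decrease with the
      exponent. For \<open>s = 0\<close> it equals \<open>1\<close>, which no cover can stay below.\<close>
    define e' :: real where "e' = min e (min 1 \<delta> powr s)"
    have "0 < ennreal e'" using e \<delta> by (simp add: e'_def)
    then obtain U :: "nat \<Rightarrow> 'a set" where
      U: "E \<subseteq> (\<Union>i. U i) \<and> (\<forall>i. bounded (U i) \<and> diameter (U i) \<in> {0<..})"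
      and sum: "(\<Sum>i. ennreal (diameter (U i) powr s)) < ennreal e'"
      using zero unfolding diam_content_def by (elim small_cover_if_content_0)
    have small: "diameter (U i) \<le> min 1 \<delta>" for i
    proof (rule ccontr)
      assume "\<not> ?thesis"
      then have "min 1 \<delta> powr s \<le> diameter (U i) powr s"
        using \<delta> s by (intro powr_mono2) auto
      then have "ennreal e' \<le> ennreal (diameter (U i) powr s)"
        by (intro ennreal_leI) (auto simp: e'_def)
      also have "\<dots> < ennreal e'"
        using le_less_trans[OF ennreal_term_le_suminf sum] .
      finally show False by simp
    qed
    have "\<forall>i. bounded (U i) \<and> diameter (U i) \<le> \<delta>" using U small by auto
    then have "hausdorff_premeasure \<delta> s' E \<le> (\<Sum>i. diam_power s' (U i))"
      unfolding hausdorff_premeasure_def using U by (intro Inf_lower) blast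
    also have "\<dots> \<le> (\<Sum>i. ennreal (diameter (U i) powr s))"
    proof (intro suminf_le summableI)
      fix i
      have "diameter (U i) powr s' \<le> diameter (U i) powr s"
        using s U small[of i] by (intro powr_mono') (auto intro: less_imp_le)
      then show "diam_power s' (U i) \<le> ennreal (diameter (U i) powr s)"
        using s by (auto simp: diam_power_def intro!: ennreal_leI)
    qed
    also have "\<dots> \<le> ennreal e'" using sum by (rule less_imp_le)
    also have "\<dots> \<le> ennreal e" by (intro ennreal_leI) (simp add: e'_def)
    finally show ?thesis by simp
  qed
  have "hausdorff_premeasure \<delta> s' E \<le> 0" if "0 < \<delta>" for \<delta>
    by (rule ennreal_le_epsilon) (rule premeasure[OF _ that])
  then have "hausdorff_measure s' E \<le> 0"
    unfolding hausdorff_measure_def by (intro SUP_least) auto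
  then show ?thesis by simp
qed

text \<open>Covers in the Hausdorff measure may contain singletons and the empty set, whose diameter \<open>0\<close> is not
  admissible. Passing to a ball of slightly larger radius costs a factor \<open>2 powr s\<close> and an arbitrarily small error.\<close>

lemma enlarge_to_positive_diameter:
  fixes U :: "'a::euclidean_space set"
  assumes U: "bounded U" and s: "0 < s" and e: "0 < e"
  obtains V where "U \<subseteq> V" "bounded V" "0 < diameter V"
    "diameter V powr s \<le> 2 powr s * diameter U powr s + e"
proof -
  let ?d = "diameter U"
  have d: "0 \<le> ?d" using U by (rule diameter_ge_0)
  have nonneg: "\<forall>\<^sub>F \<eta> in at_right 0. 0 \<le> 2 * (?d + \<eta>)"
    using eventually_at_right_less[of 0] by eventually_elim (use d in auto)
  have "((\<lambda>\<eta>. (2 * (?d + \<eta>)) powr s) \<longlongrightarrow> (2 * (?d + 0)) powr s) (at_right 0)"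
    using s nonneg by (intro tendsto_powr' tendsto_intros) auto
  then have "\<forall>\<^sub>F \<eta> in at_right 0. (2 * (?d + \<eta>)) powr s < (2 * ?d) powr s + e"
    using e by (intro order_tendstoD(2)) auto
  then have "\<forall>\<^sub>F \<eta> in at_right 0. (2 * (?d + \<eta>)) powr s < (2 * ?d) powr s + e \<and> 0 < \<eta>"
    by (intro eventually_conj eventually_at_right_less)
  then obtain \<eta> where \<eta>: "(2 * (?d + \<eta>)) powr s < (2 * ?d) powr s + e" "0 < \<eta>"
    using eventually_happens'[OF trivial_limit_at_right_real[of 0]] by blast
  obtain x where x: "U \<subseteq> cball x (?d + \<eta>)"
  proof (cases "U = {}")
    case False
    then obtain x where "x \<in> U" by blast
    then have "U \<subseteq> cball x (?d + \<eta>)"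
      using diameter_bounded_bound[OF U] \<eta>(2) by fastforce
    then show ?thesis by (rule that)
  qed (use that in auto)
  show ?thesis
    by (rule that[OF x]) (use \<eta> d in \<open>auto simp: powr_mult\<close>)
qed

lemma diam_content_eq_0_if_hausdorff_measure_eq_0:
  fixes E :: "'a::euclidean_space set"
  assumes zero: "hausdorff_measure s E = 0" and s: "0 \<le> s" "s < s'"
  shows "diam_content {0<..} s' E = 0"
proof -
  have "hausdorff_premeasure 1 s E \<le> hausdorff_measure s E"
    unfolding hausdorff_measure_def by (rule SUP_upper) simp
  then have pre: "hausdorff_premeasure 1 s E = 0" using zero by simp
  have "diam_content {0<..} s' E \<le> 0 + ennreal \<epsilon>" if \<epsilon>: "0 < \<epsilon>" for \<epsilon> :: real
  proof -
    define e where "e = \<epsilon> / (2 powr s' + 1)"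
    have "0 < 2 powr s' + (1::real)" by (simp add: add_pos_pos)
    then have "0 < e" "(2 powr s' + 1) * e = \<epsilon>" using \<epsilon> by (auto simp: e_def)
    then have e: "0 < e" "2 powr s' * e + e = \<epsilon>" by (auto simp: algebra_simps)
    then have "0 < ennreal e" by simp
    then obtain U :: "nat \<Rightarrow> 'a set" where
      U: "E \<subseteq> (\<Union>i. U i) \<and> (\<forall>i. bounded (U i) \<and> diameter (U i) \<le> 1)"
      and sum: "(\<Sum>i. diam_power s (U i)) < ennreal e"
      using pre unfolding hausdorff_premeasure_def by (elim small_cover_if_content_0)
    have "\<exists>V. U i \<subseteq> V \<and> bounded V \<and> 0 < diameter V \<and>
      diameter V powr s' \<le> 2 powr s' * diameter (U i) powr s' + e * (1/2) ^ Suc i" for i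
      using enlarge_to_positive_diameter[of "U i" s' "e * (1/2) ^ Suc i"] U s e by force
    then obtain V where V: "\<And>i. U i \<subseteq> V i" "\<And>i. bounded (V i)" "\<And>i. 0 < diameter (V i)"
      "\<And>i. diameter (V i) powr s' \<le> 2 powr s' * diameter (U i) powr s' + e * (1/2) ^ Suc i"
      by metis
    have gauge: "ennreal (diameter (U i) powr s') \<le> diam_power s (U i)" for i
    proof (cases "s = 0")
      case True
      then show ?thesis
        using U s diameter_ge_0[of "U i"] by (auto simp: diam_power_def powr_le1)
    next
      case False
      then show ?thesis
        using U s diameter_ge_0[of "U i"] by (auto simp: diam_power_def intro!: ennreal_leI powr_mono')
    qed
    have "E \<subseteq> (\<Union>i. V i) \<and> (\<forall>i. bounded (V i) \<and> diameter (V i) \<in> {0<..})"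
      using U V(1-3) by (simp add: subset_iff) blast
    then have "diam_content {0<..} s' E \<le> (\<Sum>i. ennreal (diameter (V i) powr s'))"
      unfolding diam_content_def by (intro Inf_lower) blast
    also have "\<dots> \<le> (\<Sum>i. ennreal (2 powr s') * diam_power s (U i) + ennreal (e * (1/2) ^ Suc i))"
    proof (intro suminf_le summableI)
      fix i
      have "ennreal (diameter (V i) powr s')
          \<le> ennreal (2 powr s') * ennreal (diameter (U i) powr s') + ennreal (e * (1/2) ^ Suc i)"
        using V(4)[of i] e by (simp add: ennreal_leI flip: ennreal_mult ennreal_plus)
      also have "\<dots> \<le> ennreal (2 powr s') * diam_power s (U i) + ennreal (e * (1/2) ^ Suc i)"
        by (intro add_right_mono mult_left_mono gauge) simp
      finally show "ennreal (diameter (V i) powr s') \<le> \<dots>" .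
    qed
    also have "\<dots> = ennreal (2 powr s') * (\<Sum>i. diam_power s (U i)) + ennreal e"
      by (subst suminf_add[OF summableI summableI, symmetric])
        (simp only: ennreal_suminf_cmult suminf_half_powers_ennreal[OF less_imp_le[OF e(1)]])
    also have "\<dots> \<le> ennreal (2 powr s') * ennreal e + ennreal e"
      using less_imp_le[OF sum] by (intro add_right_mono mult_left_mono) simp_all
    also have "\<dots> = ennreal \<epsilon>"
      using e by (simp flip: ennreal_mult ennreal_plus)
    finally show ?thesis by simp
  qed
  then have "diam_content {0<..} s' E \<le> 0" by (rule ennreal_le_epsilon)
  then show ?thesis by simp
qed

lemma hausdorff_dim_eq_diam_hausdorff_dim:
  fixes E :: "'a::euclidean_space set"
  shows "hausdorff_dim E = diam_hausdorff_dim {0<..} E"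
  unfolding hausdorff_dim_def diam_hausdorff_dim_def
  by (rule Inf_eq_if_slack)
    (auto intro: hausdorff_measure_eq_0_if_diam_content_eq_0 diam_content_eq_0_if_hausdorff_measure_eq_0)

section \<open>Packing dimension\<close>

text \<open>Eventually \<open>d n \<le> s * n\<close>, so a ball of radius comparable to \<open>2\<^sup>-\<^sup>n\<close> contributes at most a constant times
  \<open>2 powr ((s - s') * n) * 2\<^sup>-\<^sup>d\<^sup>n\<close>. The first factor is small for small radii, and the second factors add up to at
  most \<open>1\<close> over a packing.\<close>

lemma packing_premeasure_digit_set_eq_0:
  assumes s: "0 \<le> s" "s < s'" and ev: "\<forall>\<^sub>F n in sequentially. digit_density S n < s"
  shows "packing_premeasure s' (digit_set S) = 0"
proof -
  have "packing_premeasure s' (digit_set S) \<le> 0 + ennreal e" if e: "0 < e" for e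
  proof -
    define b :: real where "b = 2 powr (s - s')"
    have b: "0 < b" "b < 1" using s by (auto simp: b_def powr_less_one)
    have "(\<lambda>n. 4 powr s' * b ^ n) \<longlonglongrightarrow> 4 powr s' * 0"
      using b by (intro tendsto_intros LIMSEQ_power_zero) auto
    then have "\<forall>\<^sub>F n in sequentially. 4 powr s' * b ^ n < e"
      using e by (intro order_tendstoD) auto
    from eventually_conj[OF this eventually_conj[OF ev eventually_gt_at_top[of 0]]]
    obtain n0 where n0: "\<And>n. n0 \<le> n \<Longrightarrow> 4 powr s' * b ^ n < e \<and> digit_density S n < s \<and> 0 < n"
      by (auto simp: eventually_sequentially)
    have term_le: "(2 * r) powr s' \<le> e * (1 / 2 ^ digit_count S n)"
      if r: "r < 2 * (1/2) ^ n" "0 < r" and n: "n0 \<le> n" for n r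
    proof -
      have "1 / 2 ^ digit_count S n = 2 powr (- real (digit_count S n))"
        by (simp add: powr_minus_divide powr_realpow)
      moreover have "digit_count S n \<le> s * n"
        using n0[OF n] digit_density_less_iff[of n S s] by simp
      ultimately have count: "2 powr (- s * n) \<le> 1 / 2 ^ digit_count S n"
        by simp
      have "(2 * r) powr s' \<le> (4 * (1/2) ^ n) powr s'"
        using r s by (intro powr_mono2) auto
      also have "\<dots> = 4 powr s' * b ^ n * 2 powr (- s * n)"
      proof -
        have "2 powr (- s' * n) = b ^ n * 2 powr (- s * n)"
          by (simp add: b_def powr_power flip: powr_add) (simp add: algebra_simps)
        then show ?thesis by (simp add: powr_mult half_power_powr)
      qed
      also have "\<dots> \<le> e * (1 / 2 ^ digit_count S n)"
        using n0[OF n] e count by (intro mult_mono) auto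
      finally show ?thesis .
    qed
    have "(\<Sum>\<^sub>\<infinity>(x, r)\<in>P. ennreal (diameter (cball x r) powr s')) \<le> ennreal e"
      if P: "P \<in> packings ((1/2) ^ n0) (digit_set S)" for P
    proof -
      have "\<exists>n. n0 \<le> n \<and> (1/2) ^ n \<le> snd p \<and> snd p < 2 * (1/2) ^ n" if p: "p \<in> P" for p
      proof -
        have r: "0 < snd p" "snd p \<le> (1/2) ^ n0"
          using P p by (auto simp: packings_def case_prod_beta)
        moreover have "(1/2::real) ^ n0 \<le> 1" by (simp add: power_le_one)
        ultimately obtain n where n: "(1/2) ^ n \<le> snd p" "snd p < 2 * (1/2) ^ n"
          using dyadic_scale_exists[of "snd p"] by auto
        then have "(1/2::real) ^ n \<le> (1/2) ^ n0" using r by linarith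
        then have "n0 \<le> n" by simp
        with n show ?thesis by blast
      qed
      then obtain N where N: "\<And>p. p \<in> P \<Longrightarrow> n0 \<le> N p" "\<And>p. p \<in> P \<Longrightarrow> (1/2) ^ N p \<le> snd p"
        "\<And>p. p \<in> P \<Longrightarrow> snd p < 2 * (1/2) ^ N p"
        by metis
      have "sum (\<lambda>(x, r). ennreal (diameter (cball x r) powr s')) F \<le> ennreal e"
        if F: "finite F" "F \<subseteq> P" for F
      proof -
        have "sum (\<lambda>(x, r). ennreal (diameter (cball x r) powr s')) F
            \<le> (\<Sum>p\<in>F. ennreal (e * (1 / 2 ^ digit_count S (N p))))"
        proof (rule sum_mono)
          fix p assume "p \<in> F"
          then have p: "p \<in> P" using F by blast
          then have "0 < snd p" using P by (auto simp: packings_def case_prod_beta)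
          with term_le[OF N(3)[OF p] _ N(1)[OF p]]
          show "(case p of (x, r) \<Rightarrow> ennreal (diameter (cball x r) powr s'))
              \<le> ennreal (e * (1 / 2 ^ digit_count S (N p)))"
            by (auto simp: case_prod_beta intro!: ennreal_leI)
        qed
        also have "\<dots> = ennreal (e * (\<Sum>p\<in>F. 1 / 2 ^ digit_count S (N p)))"
          using e by (subst sum_ennreal) (auto simp: sum_distrib_left)
        also have "\<dots> \<le> ennreal e"
        proof -
          have "(\<Sum>p\<in>F. 1 / 2 ^ digit_count S (N p) :: real) \<le> 1"
          proof (rule digit_set_packing_bound[OF F(1)])
            show "disjoint_family_on (\<lambda>(x, r). cball x r) F"
              using P F by (auto simp: packings_def intro: disjoint_family_on_mono)
          qed (use P F N(2) in \<open>auto simp: packings_def\<close>)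
          then show ?thesis using e by (intro ennreal_leI) (simp add: mult_left_le)
        qed
        finally show ?thesis .
      qed
      then show ?thesis
        by (subst nonneg_infsum_complete) (auto intro!: SUP_least)
    qed
    then have "(SUP P\<in>packings ((1/2) ^ n0) (digit_set S).
        \<Sum>\<^sub>\<infinity>(x, r)\<in>P. ennreal (diameter (cball x r) powr s')) \<le> ennreal e"
      by (rule SUP_least)
    then show ?thesis
      unfolding packing_premeasure_def by (intro INF_lower2[of "(1/2) ^ n0"]) auto
  qed
  then have "packing_premeasure s' (digit_set S) \<le> 0" by (rule ennreal_le_epsilon)
  then show ?thesis by simp
qed

text \<open>If few dyadic intervals of some generation meet \<open>V\<close>, then they cover \<open>V\<close> with small total
  length.\<close>

lemma nonnegligible_dyadic_count:
  fixes V :: "real set"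
  assumes V: "V \<subseteq> {0..<1}" "\<not> negligible V"
  obtains c :: real where "0 < c" "\<And>k. c * 2 ^ k \<le> card ((\<lambda>t. \<lfloor>2 ^ k * t\<rfloor>) ` V)"
proof -
  obtain c where c: "0 < c" "\<And>T. V \<subseteq> T \<Longrightarrow> T \<in> lmeasurable \<Longrightarrow> c < measure lebesgue T"
    using V(2) unfolding negligible_outer_le by (auto simp: not_le)
  have "c * 2 ^ k \<le> card ((\<lambda>t. \<lfloor>2 ^ k * t\<rfloor>) ` V)" for k
  proof -
    let ?J = "(\<lambda>t::real. \<lfloor>2 ^ k * t\<rfloor>) ` V"
    let ?I = "\<lambda>j::int. {j / 2 ^ k..(j + 1) / 2 ^ k :: real}"
    have "?J \<subseteq> {0..2 ^ k}"
    proof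
      fix j assume "j \<in> ?J"
      then obtain t where t: "t \<in> V" "j = \<lfloor>2 ^ k * t\<rfloor>" by blast
      then have "0 \<le> 2 ^ k * t" "2 ^ k * t \<le> 2 ^ k * 1"
        using V(1) by (auto intro!: mult_left_mono simp del: mult_1_right)
      then have "\<lfloor>0::real\<rfloor> \<le> j" "j \<le> \<lfloor>2 ^ k * 1 :: real\<rfloor>"
        unfolding t by (simp_all only: floor_mono)
      moreover have "\<lfloor>2 ^ k * 1 :: real\<rfloor> = 2 ^ k" by (simp add: floor_eq_iff)
      ultimately show "j \<in> {0..2 ^ k}" by simp
    qed
    then have fin: "finite ?J" by (rule finite_subset) simp
    have "V \<subseteq> (\<Union>j\<in>?J. ?I j)"
    proof
      fix t assume "t \<in> V"
      moreover have "t \<in> ?I \<lfloor>2 ^ k * t\<rfloor>"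
        using of_int_floor_le[of "2 ^ k * t"] real_of_int_floor_add_one_ge[of "2 ^ k * t"]
        by (simp add: field_simps)
      ultimately show "t \<in> (\<Union>j\<in>?J. ?I j)" by blast
    qed
    moreover have "(\<Union>j\<in>?J. ?I j) \<in> lmeasurable"
      using fin by (intro fmeasurable.finite_UN) auto
    ultimately have "c < measure lebesgue (\<Union>j\<in>?J. ?I j)" by (rule c(2))
    also have "\<dots> \<le> (\<Sum>j\<in>?J. measure lebesgue (?I j))"
      using fin by (intro measure_UNION_le) auto
    also have "\<dots> = card ?J / 2 ^ k"
      by (simp add: divide_right_mono flip: diff_divide_distrib)
    finally show ?thesis by (simp add: field_simps)
  qed
  with c(1) show ?thesis by (rule that)
qed

lemma half_with_gaps:
  fixes J :: "int set"
  assumes "finite J"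
  obtains K where "K \<subseteq> J" "card J \<le> 2 * card K" "\<And>i j. i \<in> K \<Longrightarrow> j \<in> K \<Longrightarrow> i < j \<Longrightarrow> i + 2 \<le> j"
proof -
  let ?E = "{j\<in>J. even j}" and ?O = "{j\<in>J. odd j}"
  have card: "card J = card ?E + card ?O"
    using assms by (subst card_Un_disjoint[symmetric]) (auto intro!: arg_cong[of _ _ card])
  have gap: "i + 2 \<le> j" if "even i = even j" "i < j" for i j :: int
    using that by presburger
  from card consider "card J \<le> 2 * card ?E" | "card J \<le> 2 * card ?O" by linarith
  then show ?thesis
  proof cases
    case 1
    then show ?thesis by (intro that[of ?E]) (auto intro: gap)
  next
    case 2
    then show ?thesis by (intro that[of ?O]) (auto intro: gap)
  qed
qed

text \<open>A set with a preimage of positive outer measure meets a fixed proportion of the cylinders at every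
  scale. Dropping every other cylinder makes the remaining ones \<open>2\<^sup>-\<^sup>n\<close>-separated, so balls of radius
  \<open>2\<^sup>-\<^sup>n / 3\<close> centred in the set form a packing whose sum is at least a constant times \<open>2 powr ((s' - s) * n)\<close> at
  every scale with \<open>d n \<ge> s' * n\<close>. The bound \<open>1\<close> is independent of the set, as is needed to
  pass to the infimum over all decompositions.\<close>

lemma packing_premeasure_ge_1:
  assumes S: "S \<subseteq> {1..}" and s: "0 \<le> s" "s < s'"
    and freq: "\<exists>\<^sub>F n in sequentially. s' \<le> digit_density S n"
    and U: "\<not> negligible {t\<in>{0..<1}. spread S t \<in> U}"
  shows "1 \<le> packing_premeasure s U"
  unfolding packing_premeasure_def
proof (rule INF_greatest)
  fix \<delta> :: real assume "\<delta> \<in> {0<..}"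
  then have \<delta>: "0 < \<delta>" by simp
  let ?V = "{t\<in>{0..<1}. spread S t \<in> U}"
  obtain c :: real where c: "0 < c" "\<And>k. c * 2 ^ k \<le> card ((\<lambda>t. \<lfloor>2 ^ k * t\<rfloor>) ` ?V)"
    by (rule nonnegligible_dyadic_count[OF _ U]) auto
  define c' where "c' = c / 2 * (2/3) powr s"
  have c': "0 < c'" using c by (simp add: c'_def)
  define b :: real where "b = 2 powr (s' - s)"
  have b: "1 < b" using s by (simp add: b_def)
  obtain m where "1 / c' < b ^ m" using real_arch_pow[OF b] by blast
  then have ev1: "\<forall>\<^sub>F n in sequentially. 1 / c' \<le> b ^ n"
    using b by (intro eventually_sequentiallyI[of m]) (auto intro: less_imp_le order_trans power_increasing)
  have "(\<lambda>n. (1/2::real) ^ n) \<longlonglongrightarrow> 0" by (rule LIMSEQ_power_zero) simp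
  then have ev2: "\<forall>\<^sub>F n in sequentially. (1/2) ^ n < \<delta>" using \<delta> by (rule order_tendstoD)
  from frequently_eventually_frequently[OF freq eventually_conj[OF eventually_conj[OF ev1 ev2] eventually_gt_at_top[of 0]]]
  obtain n where n: "s' \<le> digit_density S n" "1 / c' \<le> b ^ n" "(1/2) ^ n < \<delta>" "0 < n"
    by (auto dest: frequently_ex)
  define d where "d = digit_count S n"
  have d: "s' * n \<le> d"
    using n(1,4) digit_density_less_iff[of n S s'] by (simp add: d_def not_less[symmetric])
  let ?J = "(\<lambda>t. \<lfloor>2 ^ d * t\<rfloor>) ` ?V"
  have "0 < c * 2 ^ d" using c(1) by simp
  then have "0 < card ?J" using c(2)[of d] by linarith
  then have "finite ?J" by (rule card_ge_0_finite)
  then obtain K where K: "K \<subseteq> ?J" "card ?J \<le> 2 * card K"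
    "\<And>i j. i \<in> K \<Longrightarrow> j \<in> K \<Longrightarrow> i < j \<Longrightarrow> i + 2 \<le> j"
    by (rule half_with_gaps) (rule that)
  have finK: "finite K" using K(1) \<open>finite ?J\<close> by (rule finite_subset)
  have "\<forall>j\<in>K. \<exists>t. t \<in> ?V \<and> \<lfloor>2 ^ d * t\<rfloor> = j" using K(1) by blast
  then obtain \<tau> where \<tau>: "\<And>j. j \<in> K \<Longrightarrow> \<tau> j \<in> ?V" "\<And>j. j \<in> K \<Longrightarrow> \<lfloor>2 ^ d * \<tau> j\<rfloor> = j"
    by metis
  have gap: "(1/2) ^ n \<le> spread S (\<tau> j) - spread S (\<tau> i)" if "i \<in> K" "j \<in> K" "i < j" for i j
  proof -
    have "\<lfloor>2 ^ d * \<tau> j\<rfloor> - \<lfloor>2 ^ d * \<tau> i\<rfloor> - 1 \<le> 2 ^ n * (spread S (\<tau> j) - spread S (\<tau> i))"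
      unfolding d_def by (rule spread_expands[OF S]) (use \<tau> that in \<open>auto simp flip: d_def\<close>)
    moreover have "real_of_int (i + 2) \<le> real_of_int j"
      using K(3)[OF that] unfolding of_int_le_iff .
    ultimately have "1 \<le> 2 ^ n * (spread S (\<tau> j) - spread S (\<tau> i))"
      using \<tau>(2) that by simp
    then show ?thesis by (simp add: field_simps power_one_over)
  qed
  define r :: real where "r = (1/2) ^ n / 3"
  have r: "0 < r" "2 * r < (1/2) ^ n" by (auto simp: r_def)
  define f where "f j = (spread S (\<tau> j), r)" for j
  have disj: "cball (spread S (\<tau> i)) r \<inter> cball (spread S (\<tau> j)) r = {}"
    if "i \<in> K" "j \<in> K" "i < j" for i j
  proof -
    have "2 * r < dist (spread S (\<tau> i)) (spread S (\<tau> j))"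
      using gap[OF that] r by (simp add: dist_real_def)
    then show ?thesis by (intro disjoint_cballI) simp
  qed
  have inj: "inj_on f K"
  proof (rule inj_onI)
    fix i j assume ij: "i \<in> K" "j \<in> K" "f i = f j"
    then have eq: "spread S (\<tau> i) = spread S (\<tau> j)" by (simp add: f_def)
    have "\<not> (1/2::real) ^ n \<le> 0" by (simp add: not_le)
    then show "i = j" using gap[of i j] gap[of j i] ij eq by (cases i j rule: linorder_cases) auto
  qed
  have "f ` K \<in> packings \<delta> U"
    unfolding packings_def
  proof (intro CollectI conjI)
    show "countable (f ` K)" using finK by (intro countable_finite) auto
    have "r \<le> \<delta>" using r n(3) by linarith
    then show "\<forall>(x, r)\<in>f ` K. x \<in> U \<and> 0 < r \<and> r \<le> \<delta>" using \<tau>(1) r(1) by (auto simp: f_def)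
    show "disjoint_family_on (\<lambda>(x, r). cball x r) (f ` K)"
      unfolding disjoint_family_on_def
    proof (intro ballI impI)
      fix p q assume "p \<in> f ` K" "q \<in> f ` K" "p \<noteq> q"
      then obtain i j where ij: "i \<in> K" "j \<in> K" "p = f i" "q = f j" "i \<noteq> j" by blast
      show "(case p of (x, r) \<Rightarrow> cball x r) \<inter> (case q of (x, r) \<Rightarrow> cball x r) = {}"
      proof (cases "i < j")
        case True
        then show ?thesis using disj[of i j] ij by (simp add: f_def)
      next
        case False
        then show ?thesis using disj[of j i] ij by (simp add: f_def Int_commute)
      qed
    qed
  qed
  then have "(\<Sum>\<^sub>\<infinity>(x, r)\<in>f ` K. ennreal (diameter (cball x r) powr s))
      \<le> (SUP P\<in>packings \<delta> U. \<Sum>\<^sub>\<infinity>(x, r)\<in>P. ennreal (diameter (cball x r) powr s))"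
    by (rule SUP_upper)
  moreover have "(\<Sum>\<^sub>\<infinity>(x, r)\<in>f ` K. ennreal (diameter (cball x r) powr s)) = ennreal (card K * (2 * r) powr s)"
  proof -
    have "(\<Sum>\<^sub>\<infinity>(x, r)\<in>f ` K. ennreal (diameter (cball x r) powr s))
        = (\<Sum>(x, r)\<in>f ` K. ennreal (diameter (cball x r) powr s))"
      using finK by (intro infsum_finite) auto
    also have "\<dots> = (\<Sum>j\<in>K. ennreal ((2 * r) powr s))"
      using r(1) by (subst sum.reindex[OF inj]) (simp add: f_def)
    finally show ?thesis by (simp add: ennreal_mult ennreal_of_nat_eq_real_of_nat)
  qed
  moreover have "1 \<le> card K * (2 * r) powr s"
  proof -
    have "1 \<le> c' * b ^ n" using n(2) c' by (simp add: field_simps)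
    also have "\<dots> = c / 2 * 2 powr (s' * n) * ((2/3) powr s * 2 powr (- s * n))"
      by (simp add: c'_def b_def powr_power flip: powr_add) (simp add: algebra_simps)
    also have "(2/3) powr s * 2 powr (- s * n) = (2 * r) powr s"
      by (simp add: r_def powr_mult powr_divide half_power_powr)
    also have "c / 2 * 2 powr (s' * n) \<le> card K"
    proof -
      have "2 powr (s' * n) \<le> 2 ^ d" using d by (simp flip: powr_realpow)
      then have "c * 2 powr (s' * n) \<le> c * 2 ^ d" using c(1) by (intro mult_left_mono) auto
      also have "\<dots> \<le> card ?J" by (rule c(2))
      also have "\<dots> \<le> 2 * card K" using K(2) by linarith
      finally show ?thesis by simp
    qed
    finally show ?thesis by (simp add: mult_right_mono)
  qed
  ultimately show "1 \<le> (SUP P\<in>packings \<delta> U. \<Sum>\<^sub>\<infinity>(x, r)\<in>P. ennreal (diameter (cball x r) powr s))"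
    using ennreal_leI[of 1] by (metis ennreal_1 order_trans)
qed

text \<open>Countably many pieces cannot all have a negligible preimage in the unit interval.\<close>

lemma packing_measure_digit_set_ge_1:
  assumes S: "S \<subseteq> {1..}" and s: "0 \<le> s" "s < s'"
    and freq: "\<exists>\<^sub>F n in sequentially. s' \<le> digit_density S n"
  shows "1 \<le> packing_measure s (digit_set S)"
  unfolding packing_measure_def
proof (rule Inf_greatest, clarify)
  fix U :: "nat \<Rightarrow> real set" assume cover: "digit_set S \<subseteq> (\<Union>i. U i)"
  have "\<exists>i. \<not> negligible {t\<in>{0..<1}. spread S t \<in> U i}"
  proof (rule ccontr)
    assume "\<not> ?thesis"
    then have "negligible (\<Union>i. {t\<in>{0..<1}. spread S t \<in> U i})"
      by (intro negligible_Union_nat) auto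
    moreover have "cbox 0 (1/2) \<subseteq> (\<Union>i. {t\<in>{0..<1}. spread S t \<in> U i})"
      using cover spread_in_digit_set[of S] by fastforce
    ultimately have "negligible (cbox 0 (1/2::real))" by (rule negligible_subset)
    then have "box 0 (1/2::real) = {}" unfolding negligible_interval .
    then show False by simp
  qed
  then obtain i where "1 \<le> packing_premeasure s (U i)"
    using packing_premeasure_ge_1[OF S s freq] by blast
  also have "\<dots> \<le> (\<Sum>i. packing_premeasure s (U i))" by (rule ennreal_term_le_suminf)
  finally show "1 \<le> (\<Sum>i. packing_premeasure s (U i))" .
qed

lemma packing_dim_digit_set:
  assumes S: "S \<subseteq> {1..}"
  shows "packing_dim (digit_set S) = upper_density S"
  unfolding packing_dim_def upper_density_def
proof (rule Inf_eq_if_slack)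
  fix a s :: real
  assume a: "a \<in> {s. 0 \<le> s \<and> packing_measure s (digit_set S) = 0}" and "a < s"
  have "\<forall>\<^sub>F n in sequentially. digit_density S n < s"
  proof (rule ccontr)
    assume "\<not> ?thesis"
    then have "\<exists>\<^sub>F n in sequentially. s \<le> digit_density S n"
      by (simp add: not_eventually not_less)
    from packing_measure_digit_set_ge_1[OF S _ \<open>a < s\<close> this] a show False by simp
  qed
  with a \<open>a < s\<close> show "s \<in> {s. 0 \<le> s \<and> (\<forall>\<^sub>F n in sequentially. digit_density S n < s)}" by auto
next
  fix b s :: real
  assume b: "b \<in> {s. 0 \<le> s \<and> (\<forall>\<^sub>F n in sequentially. digit_density S n < s)}" and "b < s"
  then have "packing_premeasure s (digit_set S) = 0"
    by (intro packing_premeasure_digit_set_eq_0) auto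
  moreover have "packing_measure s (digit_set S) \<le> (\<Sum>i::nat. packing_premeasure s (digit_set S))"
    unfolding packing_measure_def by (rule Inf_lower) (auto intro!: exI[of _ "\<lambda>_. digit_set S"])
  ultimately show "s \<in> {s. 0 \<le> s \<and> packing_measure s (digit_set S) = 0}" using b \<open>b < s\<close> by auto
qed auto

section \<open>Intermediate densities\<close>

lemma digit_density_step:
  assumes "S \<subseteq> {1..}"
  shows "\<bar>digit_density S (Suc n) - digit_density S n\<bar> \<le> inverse (Suc n)"
proof (cases "n = 0")
  case True
  then show ?thesis
    using digit_density_nonneg[of S 1] digit_density_le_1[OF assms, of 1]
    by (simp add: digit_density_def)
next
  case False
  let ?b = "of_bool (Suc n \<in> S) :: real"
  have "digit_density S (Suc n) - digit_density S n
      = (?b - digit_density S n) * inverse (Suc n)"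
    using False by (simp add: digit_density_def digit_count_Suc field_simps)
  moreover have "\<bar>?b - digit_density S n\<bar> \<le> 1"
    using digit_density_nonneg[of S n] digit_density_le_1[OF assms, of n] by auto
  ultimately show ?thesis
    using mult_right_mono[of "\<bar>?b - digit_density S n\<bar>" 1 "inverse (Suc n)"]
    by (simp add: abs_mult)
qed

lemma lower_density_along_bounds:
  assumes S: "S \<subseteq> {1..}" and M: "\<exists>\<^sub>F n in sequentially. n \<in> M"
  shows "lower_density_along UNIV S \<le> lower_density_along M S" "lower_density_along M S \<le> upper_density S"
proof -
  have two: "digit_density S n < 2" for n using digit_density_le_1[OF S, of n] by simp
  let ?A = "\<lambda>M. {s. 0 \<le> s \<and> (\<exists>\<^sub>F n in sequentially. n \<in> M \<and> digit_density S n < s)}"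
  have bdd: "bdd_below (?A M)" for M by (auto intro: bdd_belowI[of _ 0])
  have "2 \<in> ?A M" using M two by simp
  then have "?A M \<noteq> {}" by blast
  then show "lower_density_along UNIV S \<le> lower_density_along M S"
    unfolding lower_density_along_def
    by (rule cInf_superset_mono[OF _ bdd]) (auto elim: frequently_elim1)
  have "2 \<in> {s. 0 \<le> s \<and> (\<forall>\<^sub>F n in sequentially. digit_density S n < s)}" using two by simp
  then have "{s. 0 \<le> s \<and> (\<forall>\<^sub>F n in sequentially. digit_density S n < s)} \<noteq> {}" by blast
  then show "lower_density_along M S \<le> upper_density S"
    unfolding lower_density_along_def upper_density_def
    by (rule cInf_superset_mono[OF _ bdd]) (use M in \<open>auto intro: frequently_eventually_frequently\<close>)
qed

text \<open>A discrete intermediate value argument: once the steps of the density are shorter than \<open>e\<close>, a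
  sequence that avoids the \<open>e\<close>-neighbourhood of \<open>c\<close> stays on one side of it.\<close>

lemma frequently_near_intermediate_density:
  assumes S: "S \<subseteq> {1..}" and c: "lower_density_along UNIV S \<le> c" "c \<le> upper_density S" and e: "0 < e"
  shows "\<exists>\<^sub>F n in sequentially. \<bar>digit_density S n - c\<bar> < e"
proof (rule ccontr)
  assume "\<not> ?thesis"
  then have far: "\<forall>\<^sub>F n in sequentially. e \<le> \<bar>digit_density S n - c\<bar>"
    by (simp add: not_frequently not_less)
  have "\<forall>\<^sub>F n in sequentially. inverse (real (Suc n)) < e"
    using LIMSEQ_inverse_real_of_nat e by (rule order_tendstoD)
  from eventually_conj[OF far this] obtain n0 where
    n0: "\<And>n. n0 \<le> n \<Longrightarrow> e \<le> \<bar>digit_density S n - c\<bar>" "\<And>n. n0 \<le> n \<Longrightarrow> inverse (real (Suc n)) < e"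
    by (auto simp: eventually_sequentially)
  have stay: "digit_density S m \<le> c - e \<longleftrightarrow> digit_density S n0 \<le> c - e" if "n0 \<le> m" for m
    using that
  proof (induction m rule: dec_induct)
    case (step m)
    then show ?case
      using digit_density_step[OF S, of m] n0(1)[of m] n0(1)[of "Suc m"] n0(2)[of m] by linarith
  qed simp
  show False
  proof (cases "digit_density S n0 \<le> c - e")
    case True
    then have le: "digit_density S m \<le> c - e" if "n0 \<le> m" for m using stay that by blast
    have "0 \<le> c - e" using le[of n0] digit_density_nonneg[of S n0] by linarith
    moreover have "\<forall>\<^sub>F n in sequentially. digit_density S n < c - e / 2"
      using e by (intro eventually_sequentiallyI[of n0]) (use le in fastforce)
    ultimately have "upper_density S \<le> c - e / 2"
      unfolding upper_density_def using e by (intro cInf_lower bdd_belowI[of _ 0]) auto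
    then show False using c e by simp
  next
    case False
    then have ge: "c + e \<le> digit_density S m" if "n0 \<le> m" for m
      using stay[OF that] n0(1)[OF that] by linarith
    have "c + e \<le> lower_density_along UNIV S"
      unfolding lower_density_along_def
    proof (rule cInf_greatest)
      have "digit_density S n < 2" for n using digit_density_le_1[OF S, of n] by simp
      then have "2 \<in> {s. 0 \<le> s \<and> (\<exists>\<^sub>F n in sequentially. n \<in> UNIV \<and> digit_density S n < s)}" by simp
      then show "{s. 0 \<le> s \<and> (\<exists>\<^sub>F n in sequentially. n \<in> UNIV \<and> digit_density S n < s)} \<noteq> {}" by blast
    next
      fix s assume "s \<in> {s. 0 \<le> s \<and> (\<exists>\<^sub>F n in sequentially. n \<in> UNIV \<and> digit_density S n < s)}"
      then obtain n where "n0 \<le> n" "digit_density S n < s"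
        by (auto simp: frequently_sequentially)
      with ge show "c + e \<le> s" by fastforce
    qed
    then show False using c e by simp
  qed
qed

lemma strict_mono_choice:
  assumes "\<And>k. \<exists>\<^sub>F n in sequentially. P k n"
  obtains g :: "nat \<Rightarrow> nat" where "strict_mono g" "\<And>k. P k (g k)"
proof -
  have ex: "\<exists>n\<ge>N. P k n" for k N
    using assms[of k] by (auto simp: frequently_sequentially)
  have "\<exists>g. \<forall>k. P k (g k) \<and> g k < g (Suc k)"
  proof (rule dependent_nat_choice)
    show "\<exists>n. P 0 n" using ex by blast
    show "\<exists>m. P (Suc k) m \<and> n < m" for n k
      using ex[of "Suc n" "Suc k"] by (auto simp: Suc_le_eq)
  qed
  then show ?thesis using that by (auto simp: strict_mono_Suc_iff)
qed

lemma lower_density_along_attains: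
  assumes S: "S \<subseteq> {1..}" and c: "lower_density_along UNIV S \<le> c" "c \<le> upper_density S"
  obtains M where "\<exists>\<^sub>F n in sequentially. n \<in> M" "lower_density_along M S = c"
proof -
  obtain g where g: "strict_mono g" "\<And>k. \<bar>digit_density S (g k) - c\<bar> < inverse (Suc k)"
    using strict_mono_choice[of "\<lambda>k n. \<bar>digit_density S n - c\<bar> < inverse (Suc k)"]
      frequently_near_intermediate_density[OF S c] by auto
  have lim: "(\<lambda>k. digit_density S (g k)) \<longlonglongrightarrow> c"
    by (rule metric_tendsto_imp_tendsto[OF LIMSEQ_inverse_real_of_nat])
      (use g(2) in \<open>auto simp: dist_real_def intro!: always_eventually less_imp_le\<close>)
  have freq: "(\<exists>\<^sub>F n in sequentially. n \<in> range g \<and> Q n)" if ev: "\<forall>\<^sub>F k in sequentially. Q (g k)" for Q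
    unfolding frequently_sequentially
  proof
    fix N
    obtain k where "N \<le> k" "Q (g k)"
      using eventually_happens[OF eventually_conj[OF ev eventually_ge_at_top[of N]]] by auto
    moreover have "k \<le> g k" by (rule seq_suble[OF g(1)])
    ultimately show "\<exists>n\<ge>N. n \<in> range g \<and> Q n" by (intro exI[of _ "g k"]) auto
  qed
  let ?A = "{s. 0 \<le> s \<and> (\<exists>\<^sub>F n in sequentially. n \<in> range g \<and> digit_density S n < s)}"
  have "0 \<le> c"
    by (rule LIMSEQ_le_const[OF lim]) (use digit_density_nonneg in blast)
  have above: "s \<in> ?A" if "c < s" for s
    using freq[OF order_tendstoD(2)[OF lim that]] that \<open>0 \<le> c\<close> by simp
  have below: "c \<le> s" if "s \<in> ?A" for s
  proof (rule ccontr)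
    assume "\<not> c \<le> s"
    then have "\<forall>\<^sub>F k in sequentially. s < digit_density S (g k)"
      by (intro order_tendstoD(1)[OF lim]) simp
    then obtain k0 where k0: "\<And>k. k0 \<le> k \<Longrightarrow> s < digit_density S (g k)"
      by (auto simp: eventually_sequentially)
    from that obtain k where "g k0 \<le> g k" "digit_density S (g k) < s"
      by (auto simp: frequently_sequentially)
    with k0[of k] show False using strict_mono_less_eq[OF g(1)] by force
  qed
  have "Inf ?A = c"
  proof (rule cInf_eq_non_empty)
    show "?A \<noteq> {}" using above[of "c + 1"] by auto
    show "y \<le> c" if "\<And>s. s \<in> ?A \<Longrightarrow> y \<le> s" for y
      by (rule dense_ge) (use that above in blast)
  qed (rule below)
  moreover have "\<exists>\<^sub>F n in sequentially. n \<in> range g" using freq[of "\<lambda>_. True"] by simp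
  ultimately show ?thesis using that[of "range g"] by (simp add: lower_density_along_def)
qed

text \<open>Half-open dyadic intervals are disjoint, so the family meets exactly the prescribed ones; being
  unions of intervals closed on the left, such families are open in the Sorgenfrey topology.\<close>

lemma diam_family_of_scales:
  assumes M: "\<exists>\<^sub>F n in sequentially. n \<in> M"
  obtains D where "D \<in> diam_families" "dyadic_scales D = M"
proof -
  define D :: "real set" where "D = (\<Union>n\<in>M. {(1/2) ^ n..<2 * (1/2) ^ n})"
  have pos: "D \<subseteq> {0<..}"
  proof
    fix r assume "r \<in> D"
    then obtain n :: nat where "(1/2) ^ n \<le> r" by (auto simp: D_def)
    moreover have "0 < (1/2::real) ^ n" by simp
    ultimately show "r \<in> {0<..}" by (simp only: greaterThan_iff less_le_trans)
  qed
  have in_D: "(1/2) ^ n \<in> D" if "n \<in> M" for n using that by (auto simp: D_def intro!: bexI[of _ n])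
  have "Inf D = 0"
  proof (rule cInf_eq_non_empty)
    show "D \<noteq> {}" using in_D frequently_ex[OF M] by blast
    show "0 \<le> r" if "r \<in> D" for r using pos that by (auto intro: less_imp_le)
    show "y \<le> 0" if y: "\<And>r. r \<in> D \<Longrightarrow> y \<le> r" for y
    proof (rule ccontr)
      assume "\<not> y \<le> 0"
      moreover have "(\<lambda>n. (1/2::real) ^ n) \<longlonglongrightarrow> 0" by (rule LIMSEQ_power_zero) simp
      ultimately have "\<forall>\<^sub>F n in sequentially. (1/2) ^ n < y" by (intro order_tendstoD(2)) auto
      from frequently_eventually_frequently[OF M this] obtain n where "n \<in> M" "(1/2) ^ n < y"
        by (auto dest: frequently_ex)
      with y[OF in_D] show False by fastforce
    qed
  qed
  moreover have "openin sorgenfrey D"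
    unfolding openin_sorgenfrey_iff
  proof
    fix t assume "t \<in> D"
    then obtain n where n: "n \<in> M" "(1/2) ^ n \<le> t" "t < 2 * (1/2) ^ n" by (auto simp: D_def)
    then have "{t..<t + (2 * (1/2) ^ n - t)} \<subseteq> D" by (auto simp: D_def intro!: bexI[of _ n])
    then show "\<exists>\<delta>>0. {t..<t + \<delta>} \<subseteq> D" using n(3) by (intro exI[of _ "2 * (1/2) ^ n - t"]) auto
  qed
  moreover have "D \<noteq> {}" using in_D frequently_ex[OF M] by blast
  ultimately have "D \<in> diam_families" using pos by (simp add: diam_families_def)
  moreover have "dyadic_scales D = M"
  proof (intro equalityI subsetI)
    fix n assume "n \<in> dyadic_scales D"
    then obtain m and r :: real where m: "m \<in> M" "(1/2) ^ m \<le> r" "r < 2 * (1/2) ^ m" "(1/2) ^ n \<le> r" "r < 2 * (1/2) ^ n"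
      by (auto simp: dyadic_scales_def D_def)
    have "(1/2::real) ^ Suc m < (1/2) ^ n" "(1/2::real) ^ Suc n < (1/2) ^ m" using m by auto
    then have "n < Suc m" "m < Suc n" by (auto dest: half_power_less_imp simp del: power_Suc)
    then have "n = m" by simp
    then show "n \<in> M" using m(1) by simp
  next
    fix n assume "n \<in> M"
    then show "n \<in> dyadic_scales D" using in_D[of n] by (auto simp: dyadic_scales_def)
  qed
  ultimately show ?thesis by (rule that)
qed

section \<open>The range of dimensions\<close>

theorem theorem3p8:
  fixes S :: "nat set"
  assumes "S \<subseteq> {1..}"
  shows "{diam_hausdorff_dim D (digit_set S) | D. D \<in> diam_families} =
    {hausdorff_dim (digit_set S)..packing_dim (digit_set S)}"
proof -
  have "dyadic_scales {0<..} = UNIV"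
  proof -
    have "(1/2) ^ n \<in> {0<..} \<inter> {(1/2) ^ n..<2 * (1/2::real) ^ n}" for n by simp
    then show ?thesis by (auto simp only: dyadic_scales_def)
  qed
  then have H: "hausdorff_dim (digit_set S) = lower_density_along UNIV S"
    by (simp add: hausdorff_dim_eq_diam_hausdorff_dim diam_hausdorff_dim_digit_set[OF assms greaterThan_0_in_diam_families])
  show ?thesis
    unfolding H packing_dim_digit_set[OF assms]
  proof (intro equalityI subsetI)
    fix d assume "d \<in> {diam_hausdorff_dim D (digit_set S) | D. D \<in> diam_families}"
    then show "d \<in> {lower_density_along UNIV S..upper_density S}"
      using lower_density_along_bounds[OF assms frequently_dyadic_scales]
      by (auto simp: diam_hausdorff_dim_digit_set[OF assms])
  next
    fix c assume "c \<in> {lower_density_along UNIV S..upper_density S}"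
    then obtain M where M: "\<exists>\<^sub>F n in sequentially. n \<in> M" "lower_density_along M S = c"
      using lower_density_along_attains[OF assms, of c] by auto
    obtain D where "D \<in> diam_families" "dyadic_scales D = M"
      by (rule diam_family_of_scales[OF M(1)])
    moreover from this have "c = diam_hausdorff_dim D (digit_set S)"
      using M(2) by (simp add: diam_hausdorff_dim_digit_set[OF assms])
    ultimately show "c \<in> {diam_hausdorff_dim D (digit_set S) | D. D \<in> diam_families}"
      by blast
  qed
qed

end
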